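(* For any two integers $n\ge k\ge 1$ there exists a finite simple graph $G(n,k)$ with $\operatorname{reg}(G(n,k))=n$ and $\operatorname{im}(G(n,k))=k$.
   Context: $\operatorname{reg}(G)=\max\{j\ge0:\widetilde H_{j-1}(\operatorname{Ind}(G[S]);\Bbbk)\neq0\text{ for some }S\subseteq V(G)\}$ is the Castelnuovo–Mumford regularity of $R/I(G)$ for the edge ideal of $G$ ($\operatorname{Ind}$ = independence complex). $\operatorname{im}(G)$ is the induced matching number: the maximum size of a set of edges no two of which share a vertex or are joined by an edge of $G$. *)

theory Defs
  imports Main
begin

definition simple_graph :: "nat set \<Rightarrow> nat set set \<Rightarrow> bool" where
  "simple_graph V E \<longleftrightarrow> finite V \<and> (\<forall>e\<in>E. e \<subseteq> V \<and> card e = 2)"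

text \<open>Independence complex of the induced subgraph G[S] (faces include the empty face).\<close>
definition ind_complex :: "nat set set \<Rightarrow> nat set \<Rightarrow> nat set set" where
  "ind_complex E S = {F. F \<subseteq> S \<and> (\<forall>e\<in>E. \<not> e \<subseteq> F)}"

text \<open>Augmented simplicial chains: a chain of faces with j vertices (dimension j-1).\<close>
definition chain_on :: "nat set set \<Rightarrow> nat \<Rightarrow> (nat set \<Rightarrow> 'k::field) \<Rightarrow> bool" where
  "chain_on K j c \<longleftrightarrow> (\<forall>F. c F \<noteq> 0 \<longrightarrow> F \<in> K \<and> card F = j)"

text \<open>Simplicial boundary with respect to the natural order of the vertices;
  the sign of removing v from a face is (-1)^(position of v).\<close>
definition bd :: "nat set set \<Rightarrow> (nat set \<Rightarrow> 'k::field) \<Rightarrow> nat set \<Rightarrow> 'k" where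
  "bd K c = (\<lambda>G. \<Sum>v\<in>(\<Union>K) - G.
      if insert v G \<in> K then (-1) ^ card {u\<in>G. u < v} * c (insert v G) else 0)"

text \<open>Reduced homology group of dimension j-1 (faces with j vertices) with coefficients in 'k is nonzero.\<close>
definition red_hom_nonzero :: "'k::field itself \<Rightarrow> nat set set \<Rightarrow> nat \<Rightarrow> bool" where
  "red_hom_nonzero _ K j \<longleftrightarrow>
     (\<exists>c :: nat set \<Rightarrow> 'k. chain_on K j c \<and> bd K c = (\<lambda>_. 0) \<and>
        \<not> (\<exists>b :: nat set \<Rightarrow> 'k. chain_on K (Suc j) b \<and> bd K b = c))"

definition reg :: "'k::field itself \<Rightarrow> nat set \<Rightarrow> nat set set \<Rightarrow> nat" where
  "reg k V E = Max {j. \<exists>S\<subseteq>V. red_hom_nonzero k (ind_complex E S) j}"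

definition induced_matching :: "nat set set \<Rightarrow> nat set set \<Rightarrow> bool" where
  "induced_matching E M \<longleftrightarrow> M \<subseteq> E \<and>
     (\<forall>e\<in>M. \<forall>f\<in>M. e \<noteq> f \<longrightarrow> e \<inter> f = {} \<and> (\<forall>g\<in>E. \<not> (g \<inter> e \<noteq> {} \<and> g \<inter> f \<noteq> {})))"

definition im :: "nat set set \<Rightarrow> nat" where
  "im E = Max (card ` {M. induced_matching E M})"

end

theory Submission
  imports Defs "HOL-Library.Nat_Bijection"
begin

text \<open>
  A graph has induced matching number at most 1 iff its complement has no induced 4-cycle, and its
  independence complex is the clique complex of the complement. Starting from two non-adjacent
  points, we repeatedly replace a 4-cycle-free graph \<open>A\<close>, whose clique complex carries a nonzero
  homology class in degree \<open>d\<close>, by a 4-cycle-free graph with such a class in degree \<open>d + 1\<close>.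
  The new graph consists of copies of a Cayley graph of a finite class-2 quotient of the
  right-angled Coxeter group of \<open>A\<close>, with the products over cliques of \<open>A\<close> as generators.
  The old complex is a retract of every vertex link, and the cubes of the corresponding finite
  quotient of the Davis complex over the simplices of the old cycle, triangulated, form the new
  cycle. It is detected by the cocycle that evaluates the old cocycle on the link of one vertex.

  Adding a vertex raises the regularity by at most 1. Take the disjoint union of \<open>k - 1\<close> edges and a
  graph with induced matching number 1 and regularity at least \<open>n\<close>, and delete vertices of the
  latter until a single edge of it is left: the regularity descends to at most \<open>k\<close>
  in steps of at most 1, hence passes through \<open>n\<close>, while the induced matching number stays \<open>k\<close>.
\<close>

section \<open>Regularity under adding a vertex\<close>

definition psgn :: "nat set \<Rightarrow> nat \<Rightarrow> 'k::field" where
  "psgn G v = (-1) ^ card {u\<in>G. u < v}"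

text \<open>Unlike \<open>bd\<close>, this depends on a vertex set only and not on the complex, so
  chains of a complex, of a deletion and of a link can be compared directly. The two operators agree
  on chains of the complex by \<open>bd_eq_bdry\<close>.\<close>

definition bdry :: "nat set \<Rightarrow> (nat set \<Rightarrow> 'k::field) \<Rightarrow> nat set \<Rightarrow> 'k" where
  "bdry S c G = (\<Sum>v\<in>S - G. psgn G v * c (insert v G))"

lemma psgn_sq: "psgn G v * psgn G v = (1::'k::field)"
  by (simp add: psgn_def flip: power_mult_distrib)

lemma psgn_cases: "psgn G v = (1::'k::field) \<or> psgn G v = (- 1 :: 'k)"
  unfolding psgn_def by (cases "even (card {u\<in>G. u < v})") auto

lemma psgn_insert:
  assumes "finite G" "u \<notin> G"
  shows "psgn (insert u G) v = (if u < v then - psgn G v else psgn G v :: 'k::field)"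
proof (cases "u < v")
  case True
  then have "{w \<in> insert u G. w < v} = insert u {w\<in>G. w < v}" by auto
  then show ?thesis using assms True by (simp add: psgn_def)
next
  case False
  then have "{w \<in> insert u G. w < v} = {w\<in>G. w < v}" by auto
  then show ?thesis using assms False by (simp add: psgn_def)
qed

lemma psgn_swap:
  assumes "finite G" "u \<notin> G" "v \<notin> G" "u \<noteq> v"
  shows "psgn G u * psgn (insert u G) v = - (psgn G v * psgn (insert v G) u :: 'k::field)"
  using assms by (simp add: psgn_insert)

lemma psgn_self_insert: "psgn (insert v G) v = psgn G v"
proof -
  have "{w \<in> insert v G. w < v} = {w\<in>G. w < v}" by auto
  then show ?thesis by (simp add: psgn_def)
qed

lemma bd_eq_bdry:
  assumes "finite S" "\<Union>K \<subseteq> S" "\<And>F. c F \<noteq> 0 \<Longrightarrow> F \<in> K"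
  shows "bd K c = bdry S c"
proof
  fix G
  have "bd K c G = (\<Sum>v\<in>\<Union>K - G. psgn G v * c (insert v G))"
    unfolding bd_def psgn_def by (rule sum.cong) (use assms(3) in auto)
  also have "\<dots> = bdry S c G"
    unfolding bdry_def
  proof (rule sum.mono_neutral_left)
    have "c (insert v G) = 0" if "v \<notin> \<Union>K" for v using assms(3) that by blast
    then show "\<forall>v\<in>S - G - (\<Union> K - G). psgn G v * c (insert v G) = 0" by auto
  qed (use assms in auto)
  finally show "bd K c G = bdry S c G" .
qed

lemma bdry_add: "bdry S (\<lambda>F. c F + d F) G = bdry S c G + bdry S d G"
  by (simp add: bdry_def algebra_simps sum.distrib)

lemma bdry_diff: "bdry S (\<lambda>F. c F - d F) G = bdry S c G - bdry S d G"
  by (simp add: bdry_def algebra_simps sum_subtractf)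

lemma bdry_subset:
  assumes "finite S" "T \<subseteq> S" "\<And>F. c F \<noteq> 0 \<Longrightarrow> F \<subseteq> T"
  shows "bdry S c G = bdry T c G"
  unfolding bdry_def
proof (rule sum.mono_neutral_right)
  have "c (insert i G) = 0" if "i \<notin> T" for i using assms(3) that by blast
  then show "\<forall>i\<in>S - G - (T - G). psgn G i * c (insert i G) = 0" by auto
qed (use assms in auto)

lemma bdry_not_subset:
  assumes "\<And>F. c F \<noteq> 0 \<Longrightarrow> F \<subseteq> T" "\<not> G \<subseteq> T"
  shows "bdry S c G = 0"
proof -
  have "c (insert v G) = 0" for v using assms by blast
  then show ?thesis by (simp add: bdry_def)
qed

lemma red_hom_nonzero_iff_bdry:
  assumes "finite S"
  shows "red_hom_nonzero TYPE('k::field) (ind_complex E S) j \<longleftrightarrow>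
    (\<exists>c :: nat set \<Rightarrow> 'k. chain_on (ind_complex E S) j c \<and> (\<forall>G. bdry S c G = 0) \<and>
        (\<forall>b. chain_on (ind_complex E S) (Suc j) b \<longrightarrow> bdry S b \<noteq> c))"
proof -
  have "bd (ind_complex E S) c = bdry S c" if "chain_on (ind_complex E S) i c"
    for i and c :: "nat set \<Rightarrow> 'k"
    using that by (intro bd_eq_bdry) (auto simp: assms chain_on_def ind_complex_def)
  then show ?thesis unfolding red_hom_nonzero_def fun_eq_iff by metis
qed

section \<open>Cones and links at a vertex\<close>

definition cone :: "nat \<Rightarrow> (nat set \<Rightarrow> 'k::field) \<Rightarrow> nat set \<Rightarrow> 'k" where
  "cone v b F = (if v \<in> F then psgn F v * b (F - {v}) else 0)"

text \<open>The signs are chosen so that \<open>cone v (link v c)\<close> is the part of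
  \<open>c\<close> on faces containing \<open>v\<close>, and the boundary of \<open>cone v b\<close>
  restricts to \<open>b\<close> on faces avoiding \<open>v\<close>.\<close>

definition link :: "nat \<Rightarrow> (nat set \<Rightarrow> 'k::field) \<Rightarrow> nat set \<Rightarrow> 'k" where
  "link v c G = (if v \<in> G then 0 else psgn G v * c (insert v G))"

lemma bdry_vertex_split:
  assumes "finite S" "v \<in> S" "v \<notin> G"
  shows "bdry S c G = link v c G + bdry (S - {v}) c G"
proof -
  have "S - G = insert v (S - {v} - G)" using assms by auto
  then show ?thesis using assms by (simp add: bdry_def link_def)
qed

lemma bdry_cone_free:
  assumes "finite S" "v \<in> S" "v \<notin> G"
  shows "bdry S (cone v b) G = b G"
proof -
  have "bdry (S - {v}) (cone v b) G = 0"
    using assms by (auto simp: bdry_def cone_def intro!: sum.neutral)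
  moreover have "link v (cone v b) G = b G"
    using assms(3) psgn_sq[of G v, where 'k='a]
    by (simp add: link_def cone_def psgn_self_insert flip: mult.assoc)
  ultimately show ?thesis by (simp add: bdry_vertex_split[OF assms])
qed

text \<open>Deleting \<open>u\<close> and \<open>v\<close> in the two possible orders gives opposite
  signs by \<open>psgn_swap\<close>, so taking the link anticommutes with the boundary.\<close>

lemma bdry_link:
  assumes "finite G" "v \<notin> G"
  shows "bdry (S - {v}) (link v c) G = - psgn G v * bdry S c (insert v G)"
proof -
  have "psgn G u * link v c (insert u G) = - psgn G v * (psgn (insert v G) u * c (insert u (insert v G)))"
    if "u \<in> S - {v} - G" for u
    using that assms psgn_swap[of G u v, where 'k='a]
    by (simp add: link_def insert_commute[of v u] flip: mult.assoc)
  then show ?thesis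
    unfolding bdry_def sum_distrib_left by (intro sum.cong) auto
qed

lemma bdry_cone:
  assumes "finite G" "v \<notin> G"
  shows "bdry S (cone v b) (insert v G) = - psgn G v * bdry (S - {v}) b G"
proof -
  have "psgn (insert v G) u * cone v b (insert u (insert v G)) = - psgn G v * (psgn G u * b (insert u G))"
    if "u \<in> S - {v} - G" for u
  proof -
    have *: "insert u (insert v G) - {v} = insert u G"
      "insert u (insert v G) = insert v (insert u G)" using that assms by auto
    have "psgn (insert v G) u * psgn (insert u G) v = - (psgn G v * psgn G u :: 'a)"
      using that assms psgn_cases[of G u, where 'k='a] psgn_cases[of G v, where 'k='a]
      by (auto simp: psgn_insert)
    moreover have "cone v b (insert u (insert v G)) = psgn (insert u G) v * b (insert u G)"
      using that assms unfolding cone_def *(1)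
      by (simp add: *(2) psgn_self_insert)
    ultimately show ?thesis by (simp flip: mult.assoc)
  qed
  moreover have "S - insert v G = S - {v} - G" by auto
  ultimately show ?thesis
    unfolding bdry_def sum_distrib_left by (intro sum.cong) auto
qed

lemma insert_in_ind_complex_iff:
  assumes "\<forall>e\<in>E. card e = 2" "v \<in> S" "v \<notin> G"
  shows "insert v G \<in> ind_complex E S \<longleftrightarrow> G \<in> ind_complex E {u\<in>S - {v}. {u, v} \<notin> E}"
proof
  assume "insert v G \<in> ind_complex E S"
  then show "G \<in> ind_complex E {u\<in>S - {v}. {u, v} \<notin> E}"
    using assms(3) by (auto simp: ind_complex_def)
next
  assume G: "G \<in> ind_complex E {u\<in>S - {v}. {u, v} \<notin> E}"
  have "\<not> e \<subseteq> insert v G" if "e \<in> E" for e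
  proof
    assume e: "e \<subseteq> insert v G"
    obtain a b where "e = {a, b}" "a \<noteq> b" using assms(1) \<open>e \<in> E\<close> by (metis card_2_iff)
    then show False using e G \<open>e \<in> E\<close> by (auto simp: ind_complex_def insert_commute)
  qed
  then show "insert v G \<in> ind_complex E S" using G assms by (auto simp: ind_complex_def)
qed

text \<open>Exactness at the middle term of deletion, complex, link in the long homology sequence of
  a vertex. The independence complex of the non-neighbours of \<open>v\<close> is the link of
  \<open>v\<close>, by \<open>insert_in_ind_complex_iff\<close>.\<close>

lemma red_hom_nonzero_vertex:
  assumes E: "\<forall>e\<in>E. card e = 2" and S: "finite S" "v \<in> S"
    and nz: "red_hom_nonzero TYPE('k::field) (ind_complex E S) (Suc i)"
    and del: "\<not> red_hom_nonzero TYPE('k) (ind_complex E (S - {v})) (Suc i)"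
  shows "red_hom_nonzero TYPE('k) (ind_complex E {u\<in>S - {v}. {u, v} \<notin> E}) i"
proof (rule ccontr)
  let ?T = "S - {v}" let ?L = "{u\<in>S - {v}. {u, v} \<notin> E}"
  assume lk: "\<not> red_hom_nonzero TYPE('k) (ind_complex E ?L) i"
  obtain c :: "nat set \<Rightarrow> 'k" where c: "chain_on (ind_complex E S) (Suc i) c" "\<And>G. bdry S c G = 0"
    and nb: "\<And>b. chain_on (ind_complex E S) (Suc (Suc i)) b \<Longrightarrow> bdry S b \<noteq> c"
    using nz red_hom_nonzero_iff_bdry[OF S(1)] by blast
  have fin: "finite ?T" "finite ?L" using S by auto
  have cS: "F \<subseteq> S" "card F = Suc i" "F \<in> ind_complex E S" if "c F \<noteq> 0" for F
    using c(1) that by (auto simp: chain_on_def ind_complex_def)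
  have dlk: "chain_on (ind_complex E ?L) i (link v c)"
    unfolding chain_on_def
  proof safe
    fix F assume F: "link v c F \<noteq> 0"
    then have *: "v \<notin> F" "c (insert v F) \<noteq> 0" by (auto simp: link_def split: if_splits)
    then show "F \<in> ind_complex E ?L"
      using cS(3) insert_in_ind_complex_iff[OF E S(2)] by blast
    have "finite F" using cS(1)[OF *(2)] S(1) by (meson finite_subset subset_insertI order.trans)
    then show "card F = i" using cS(2)[OF *(2)] * by simp
  qed
  have dL: "F \<subseteq> ?L" if "link v c F \<noteq> 0" for F
    using dlk that by (auto simp: chain_on_def ind_complex_def)
  have "bdry ?L (link v c) G = 0" for G
  proof (cases "G \<subseteq> ?T")
    case True
    then have "finite G" using fin finite_subset by blast
    moreover have "v \<notin> G" using True by auto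
    ultimately have "bdry ?T (link v c) G = 0" by (simp add: bdry_link c(2))
    moreover have "bdry ?T (link v c) G = bdry ?L (link v c) G"
      by (rule bdry_subset) (use fin dL in auto)
    ultimately show ?thesis by simp
  next
    case False
    then show ?thesis using bdry_not_subset[of "link v c" ?T G] dL by blast
  qed
  then obtain b1 where b1: "chain_on (ind_complex E ?L) (Suc i) b1" "bdry ?L b1 = link v c"
    using lk dlk red_hom_nonzero_iff_bdry[OF fin(2)] by blast
  have b1L: "F \<subseteq> ?L" "card F = Suc i" "F \<in> ind_complex E ?L" if "b1 F \<noteq> 0" for F
    using b1(1) that by (auto simp: chain_on_def ind_complex_def)
  have b1T: "bdry ?T b1 = link v c"
    using bdry_subset[of ?T ?L b1] b1(2) b1L fin by fastforce
  \<comment> \<open>Since \<open>b1\<close> fills the link of the cycle, it closes up the part of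
    \<open>c\<close> away from \<open>v\<close> inside the deletion.\<close>
  define c' where "c' F = (if v \<in> F then 0 else c F + b1 F)" for F
  have c': "chain_on (ind_complex E ?T) (Suc i) c'"
    unfolding chain_on_def
  proof safe
    fix F assume F: "c' F \<noteq> 0"
    then have *: "v \<notin> F" "c F \<noteq> 0 \<or> b1 F \<noteq> 0" by (auto simp: c'_def split: if_splits)
    show "F \<in> ind_complex E ?T"
      using * cS(3)[of F] b1L(3)[of F] by (auto simp: ind_complex_def)
    show "card F = Suc i" using * cS(2)[of F] b1L(2)[of F] by blast
  qed
  have "bdry ?T c' G = 0" for G
  proof (cases "v \<in> G")
    case True
    then show ?thesis by (simp add: bdry_def c'_def)
  next
    case False
    have "bdry ?T c' G = bdry ?T (\<lambda>F. c F + b1 F) G"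
      unfolding bdry_def by (rule sum.cong) (use False in \<open>auto simp: c'_def\<close>)
    also have "\<dots> = bdry ?T c G + link v c G" by (simp add: bdry_add b1T)
    also have "\<dots> = bdry S c G" by (simp add: bdry_vertex_split[OF S False])
    finally show ?thesis by (simp add: c(2))
  qed
  then obtain b2 where b2: "chain_on (ind_complex E ?T) (Suc (Suc i)) b2" "bdry ?T b2 = c'"
    using del c' red_hom_nonzero_iff_bdry[OF fin(1)] by blast
  have b2T: "F \<subseteq> ?T" "card F = Suc (Suc i)" "F \<in> ind_complex E ?T" if "b2 F \<noteq> 0" for F
    using b2(1) that by (auto simp: chain_on_def ind_complex_def)
  have b2S: "bdry S b2 = c'"
    using bdry_subset[of S ?T b2] b2(2) b2T S by fastforce
  \<comment> \<open>The chain \<open>b2\<close> fills the closed-up part; subtracting the cone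
    removes the added \<open>b1\<close> and restores the faces through \<open>v\<close>.\<close>
  define b where "b F = b2 F - cone v b1 F" for F
  have b: "chain_on (ind_complex E S) (Suc (Suc i)) b"
    unfolding chain_on_def
  proof safe
    fix F assume F: "b F \<noteq> 0"
    then consider "b2 F \<noteq> 0" | "v \<in> F" "b1 (F - {v}) \<noteq> 0"
      by (cases "b2 F = 0") (auto simp: b_def cone_def split: if_splits)
    then have "F \<in> ind_complex E S \<and> card F = Suc (Suc i)"
    proof cases
      case 1
      then show ?thesis using b2T[of F] by (auto simp: ind_complex_def)
    next
      case 2
      have "insert v (F - {v}) \<in> ind_complex E S"
        using insert_in_ind_complex_iff[OF E S(2)] b1L(3)[OF 2(2)] by blast
      moreover have "finite (F - {v})" using b1L(1)[OF 2(2)] fin(2) finite_subset by blast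
      ultimately show ?thesis using b1L(2)[OF 2(2)] 2(1)
        by (simp add: insert_absorb)
    qed
    then show "F \<in> ind_complex E S" "card F = Suc (Suc i)" by auto
  qed
  have "bdry S b G = c G" for G
  proof (cases "v \<in> G")
    case False
    then show ?thesis
      unfolding b_def bdry_diff by (simp add: b2S bdry_cone_free[OF S] c'_def)
  next
    case True
    show ?thesis
    proof (cases "finite G")
      case fG: True
      define H where "H = G - {v}"
      have H: "G = insert v H" "v \<notin> H" "finite H" using True fG by (auto simp: H_def)
      have "bdry S b G = psgn H v * link v c H"
        unfolding b_def bdry_diff using True by (simp add: b2S H(1) bdry_cone[OF H(3,2)] b1T c'_def)
      also have "\<dots> = c G" using H psgn_sq[of H v, where 'k='k]
        by (simp add: link_def flip: mult.assoc)
      finally show ?thesis .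
    next
      case False
      then have "\<not> G \<subseteq> S" using S finite_subset by blast
      moreover have "F \<subseteq> S" if "b F \<noteq> 0" for F
        using b that by (auto simp: chain_on_def ind_complex_def)
      ultimately show ?thesis using bdry_not_subset[of b S] cS(1) by metis
    qed
  qed
  then show False using nb[OF b] by blast
qed

text \<open>Coning with any vertex contracts a full simplex: every cycle is the boundary of its
  cone.\<close>

lemma red_hom_nonzero_simplex:
  assumes S: "finite S" "S \<noteq> {}" and E: "\<forall>e\<in>E. \<not> e \<subseteq> S"
  shows "\<not> red_hom_nonzero TYPE('k::field) (ind_complex E S) j"
proof
  assume "red_hom_nonzero TYPE('k) (ind_complex E S) j"
  then obtain c :: "nat set \<Rightarrow> 'k" where c: "chain_on (ind_complex E S) j c" "\<And>G. bdry S c G = 0"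
    and nb: "\<And>b. chain_on (ind_complex E S) (Suc j) b \<Longrightarrow> bdry S b \<noteq> c"
    using red_hom_nonzero_iff_bdry[OF S(1)] by blast
  obtain v where v: "v \<in> S" using S by blast
  have K: "ind_complex E S = Pow S" using E by (auto simp: ind_complex_def)
  have cS: "F \<subseteq> S" "card F = j" if "c F \<noteq> 0" for F
    using c(1) that by (auto simp: chain_on_def ind_complex_def)
  have "chain_on (ind_complex E S) (Suc j) (cone v c)"
    unfolding chain_on_def K
  proof safe
    fix F x assume F: "cone v c F \<noteq> 0"
    then have *: "v \<in> F" "c (F - {v}) \<noteq> 0" by (auto simp: cone_def split: if_splits)
    show "x \<in> S" if "x \<in> F" using cS(1)[OF *(2)] that v by auto
    have "finite (F - {v})" using cS(1)[OF *(2)] S(1) finite_subset by blast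
    then show "card F = Suc j" using cS(2)[OF *(2)] *(1) by (metis card_Suc_Diff1 finite_Diff2 finite.emptyI finite_insert)
  qed
  moreover have "bdry S (cone v c) G = c G" for G
  proof (cases "v \<in> G")
    case False
    then show ?thesis by (simp add: bdry_cone_free[OF S(1) v])
  next
    case True
    show ?thesis
    proof (cases "finite G")
      case fG: True
      define H where "H = G - {v}"
      have H: "G = insert v H" "v \<notin> H" "finite H" using True fG by (auto simp: H_def)
      have "bdry (S - {v}) c H = - link v c H"
        using bdry_vertex_split[OF S(1) v H(2), of c] c(2) by (simp add: eq_neg_iff_add_eq_0 add.commute)
      then have "bdry S (cone v c) G = psgn H v * link v c H"
        by (simp add: H(1) bdry_cone[OF H(3,2)])
      also have "\<dots> = c G" using H psgn_sq[of H v, where 'k='k]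
        by (simp add: link_def flip: mult.assoc)
      finally show ?thesis .
    next
      case False
      then have "\<not> G \<subseteq> S" using S finite_subset by blast
      moreover have "F \<subseteq> S" if "cone v c F \<noteq> 0" for F
        using \<open>chain_on (ind_complex E S) (Suc j) (cone v c)\<close> that by (auto simp: chain_on_def ind_complex_def)
      ultimately show ?thesis using bdry_not_subset[of "cone v c" S] cS(1) by metis
    qed
  qed
  ultimately show False using nb by blast
qed

section \<open>Bounds on the regularity\<close>

abbreviation reg_set :: "'k::field itself \<Rightarrow> nat set \<Rightarrow> nat set set \<Rightarrow> nat set" where
  "reg_set k V E \<equiv> {j. \<exists>S\<subseteq>V. red_hom_nonzero k (ind_complex E S) j}"

lemma finite_reg_set:
  assumes "finite V"
  shows "finite (reg_set TYPE('k::field) V E)"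
proof (rule finite_subset)
  show "reg_set TYPE('k) V E \<subseteq> {..card V}"
  proof
    fix j assume "j \<in> reg_set TYPE('k) V E"
    then obtain S where S: "S \<subseteq> V" and nz: "red_hom_nonzero TYPE('k) (ind_complex E S) j" by blast
    have fS: "finite S" using S assms finite_subset by blast
    obtain c :: "nat set \<Rightarrow> 'k" where c: "chain_on (ind_complex E S) j c"
      and nb: "\<And>b. chain_on (ind_complex E S) (Suc j) b \<Longrightarrow> bdry S b \<noteq> c"
      using nz red_hom_nonzero_iff_bdry[OF fS] by blast
    have "chain_on (ind_complex E S) (Suc j) (\<lambda>_. 0 :: 'k)" by (simp add: chain_on_def)
    from nb[OF this] obtain F where "c F \<noteq> 0" by (fastforce simp: bdry_def)
    then have "F \<subseteq> S" "card F = j" using c unfolding chain_on_def ind_complex_def by blast+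
    then show "j \<in> {..card V}" using S assms card_mono by (metis atMost_iff order.trans)
  qed
qed simp

text \<open>For \<open>S = {}\<close> the only face is the empty one, and the chain on it bounds
  nothing. Thus the maximum in \<open>reg\<close> is taken over a non-empty set.\<close>

lemma zero_in_reg_set:
  assumes "\<forall>e\<in>E. card e = 2"
  shows "0 \<in> reg_set TYPE('k::field) V E"
proof -
  have K: "ind_complex E {} = {{}}" using assms by (auto simp: ind_complex_def)
  define c :: "nat set \<Rightarrow> 'k" where "c F = (if F = {} then 1 else 0)" for F
  have "bdry {} b \<noteq> c" for b :: "nat set \<Rightarrow> 'k"
    by (auto simp: bdry_def c_def fun_eq_iff)
  then have "red_hom_nonzero TYPE('k) (ind_complex E {}) 0"
    unfolding red_hom_nonzero_iff_bdry[OF finite.emptyI] unfolding K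
    by (intro exI[of _ c]) (auto simp: chain_on_def c_def bdry_def)
  then show ?thesis by blast
qed

lemma reg_ge:
  assumes "finite V" "S \<subseteq> V" "red_hom_nonzero TYPE('k::field) (ind_complex E S) j"
  shows "j \<le> reg TYPE('k) V E"
  unfolding reg_def using assms by (intro Max_ge finite_reg_set) auto

lemma reg_le:
  assumes "finite V" "\<forall>e\<in>E. card e = 2"
    "\<And>S j. S \<subseteq> V \<Longrightarrow> red_hom_nonzero TYPE('k::field) (ind_complex E S) j \<Longrightarrow> j \<le> r"
  shows "reg TYPE('k) V E \<le> r"
  unfolding reg_def
proof (rule Max.boundedI)
  show "finite (reg_set TYPE('k) V E)" by (rule finite_reg_set[OF assms(1)])
  show "reg_set TYPE('k) V E \<noteq> {}" using zero_in_reg_set[OF assms(2)] by (metis empty_iff)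
qed (use assms(3) in blast)

lemma reg_mono:
  assumes "finite V" "\<forall>e\<in>E. card e = 2" "U \<subseteq> V"
  shows "reg TYPE('k::field) U E \<le> reg TYPE('k) V E"
  using assms by (intro reg_le reg_ge) (auto intro: finite_subset)

text \<open>By \<open>red_hom_nonzero_vertex\<close>, a class on a set \<open>S\<close> containing
  \<open>v\<close> forces one on \<open>S - {v}\<close> in the same degree or one on the
  non-neighbours of \<open>v\<close> one degree lower.\<close>

lemma reg_insert_le:
  assumes V: "finite V" and E: "\<forall>e\<in>E. card e = 2"
  shows "reg TYPE('k::field) (insert v V) E \<le> Suc (reg TYPE('k) V E)"
proof (rule reg_le)
  fix S j assume S: "S \<subseteq> insert v V" and nz: "red_hom_nonzero TYPE('k) (ind_complex E S) j"
  have fS: "finite S" using S V finite_subset by blast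
  show "j \<le> Suc (reg TYPE('k) V E)"
  proof (cases "v \<in> S \<and> j \<noteq> 0")
    case False
    then show ?thesis using reg_ge[OF V _ nz] S by fastforce
  next
    case True
    then obtain i where j: "j = Suc i" by (cases j) auto
    have "red_hom_nonzero TYPE('k) (ind_complex E (S - {v})) (Suc i) \<or>
      red_hom_nonzero TYPE('k) (ind_complex E {u\<in>S - {v}. {u, v} \<notin> E}) i"
      using red_hom_nonzero_vertex[OF E fS] True nz j by blast
    moreover have "S - {v} \<subseteq> V" "{u\<in>S - {v}. {u, v} \<notin> E} \<subseteq> V" using S by auto
    ultimately have "Suc i \<le> reg TYPE('k) V E \<or> i \<le> reg TYPE('k) V E"
      using reg_ge[OF V, of "S - {v}" E "Suc i", where 'k='k]
        reg_ge[OF V, of "{u\<in>S - {v}. {u, v} \<notin> E}" E i, where 'k='k] by argo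
    then show ?thesis unfolding j by linarith
  qed
qed (use V E in auto)

lemma reg_edgeless:
  assumes "finite V" "\<forall>e\<in>E. card e = 2" "\<forall>e\<in>E. \<not> e \<subseteq> V"
  shows "reg TYPE('k::field) V E = 0"
proof -
  have "reg TYPE('k) V E \<le> 0"
  proof (rule reg_le)
    fix S j assume S: "S \<subseteq> V" and nz: "red_hom_nonzero TYPE('k) (ind_complex E S) j"
    then have "S = {}"
      using red_hom_nonzero_simplex[of S E, where 'k='k] assms by (meson finite_subset order.trans)
    then show "j \<le> 0"
    proof -
      obtain c :: "nat set \<Rightarrow> 'k" where c: "chain_on (ind_complex E S) j c"
        and nb: "\<And>b. chain_on (ind_complex E S) (Suc j) b \<Longrightarrow> bdry S b \<noteq> c"
        using nz red_hom_nonzero_iff_bdry[of S] \<open>S = {}\<close> by blast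
      have "chain_on (ind_complex E S) (Suc j) (\<lambda>_. 0 :: 'k)" by (simp add: chain_on_def)
      from nb[OF this] obtain F where "c F \<noteq> 0" by (fastforce simp: bdry_def)
      then show ?thesis using c \<open>S = {}\<close> by (auto simp: chain_on_def ind_complex_def)
    qed
  qed (use assms in auto)
  then show ?thesis by simp
qed

lemma reg_Un_le:
  assumes "finite D" "finite V" "\<forall>e\<in>E. card e = 2"
  shows "reg TYPE('k::field) (D \<union> V) E \<le> card D + reg TYPE('k) V E"
  using assms(1)
proof (induction D)
  case (insert v D)
  then show ?case using reg_insert_le[of "D \<union> V" E v, where 'k='k] assms by auto
qed auto

section \<open>Doubling a 4-cycle-free complex\<close>

definition indep :: "(nat \<Rightarrow> nat \<Rightarrow> bool) \<Rightarrow> nat set \<Rightarrow> bool" where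
  "indep N F \<longleftrightarrow> (\<forall>x\<in>F. \<forall>y\<in>F. \<not> N x y)"

text \<open>The relation \<open>N\<close> below is non-adjacency, i.e. the edge relation of the graph whose
  independence complex is studied; \<open>gap_free N\<close> says that this graph has no induced \<open>2K\<^sub>2\<close>.\<close>
definition gap_free :: "('a \<Rightarrow> 'a \<Rightarrow> bool) \<Rightarrow> bool" where
  "gap_free N \<longleftrightarrow> (\<forall>s t p q. N s t \<and> N p q \<longrightarrow> N s p \<or> N s q \<or> N t p \<or> N t q)"

text \<open>An element of the group is encoded by the parities \<open>h\<close> of the generators in a word and,
  for each non-commuting pair \<open>(a, x)\<close>, the parity \<open>c\<close> of the number of occurrences of \<open>x\<close> before
  an occurrence of \<open>a\<close>; multiplication by a clique \<open>\<sigma>\<close> flips \<open>h\<close> on \<open>\<sigma>\<close>, and \<open>c\<close> at the pairs in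
  \<open>\<sigma> \<times> h\<close>.\<close>
type_synonym vert = "nat set \<times> (nat \<times> nat) set"

text \<open>Adjacency in the Cayley graph, with equality allowed: \<open>q\<close> is
  \<open>p\<close> times the clique \<open>sym_diff (fst p) (fst q)\<close>. It is symmetric, since
  \<open>N a x\<close> with \<open>a\<close> in the clique keeps \<open>x\<close> out of it, so that
  \<open>x\<close> lies in both or neither of \<open>fst p\<close> and \<open>fst q\<close>.\<close>

definition linked :: "(nat \<Rightarrow> nat \<Rightarrow> bool) \<Rightarrow> vert \<Rightarrow> vert \<Rightarrow> bool" where
  "linked N p q \<longleftrightarrow> indep N (sym_diff (fst p) (fst q)) \<and>
     (\<forall>a x. ((a, x) \<in> snd p) \<noteq> ((a, x) \<in> snd q) \<longleftrightarrow>
        a \<in> sym_diff (fst p) (fst q) \<and> x \<in> fst p \<and> N a x)"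

lemma linked_refl: "linked N p p"
  by (auto simp: linked_def indep_def)

lemma linked_sym: "linked N p q \<Longrightarrow> linked N q p"
  unfolding linked_def indep_def by (simp add: Un_commute) blast

lemma linked_indepD:
  assumes "linked N p q" "x \<in> sym_diff (fst p) (fst q)" "y \<in> sym_diff (fst p) (fst q)"
  shows "\<not> N x y"
proof -
  have "indep N (sym_diff (fst p) (fst q))" using assms(1) unfolding linked_def by (rule conjunct1)
  then show ?thesis using assms(2,3) unfolding indep_def by (elim ballE) auto
qed

lemma linked_sndD:
  assumes "linked N p q"
  shows "((a, x) \<in> snd p) \<noteq> ((a, x) \<in> snd q) \<longleftrightarrow>
    a \<in> sym_diff (fst p) (fst q) \<and> x \<in> fst p \<and> N a x"
  using assms unfolding linked_def by (elim conjE allE) assumption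

text \<open>If \<open>p0\<close> and \<open>p2\<close> differ by a non-clique, then two non-commuting generators are used along
  \<open>p0, p1, p2\<close>; comparing with \<open>p0, p3, p2\<close>, the parity \<open>c\<close> forces both paths to use them in the
  same order. The two diagonals of a square then yield an induced square of the old graph.\<close>
lemma linked_square_half:
  assumes "symp N"
    and l: "linked N p0 p1" "linked N p1 p2" "linked N p2 p3" "linked N p3 p0" and "\<not> linked N p0 p2"
  obtains s t where "N s t"
    "s \<in> sym_diff (fst p0) (fst p1)" "s \<in> sym_diff (fst p3) (fst p0)"
    "t \<in> sym_diff (fst p1) (fst p2)" "t \<in> sym_diff (fst p2) (fst p3)"
proof -
  have sym: "N x y \<Longrightarrow> N y x" for x y using assms(1) by (rule sympD)
  note outer = that
  note i = l[THEN linked_indepD] and c = l[THEN linked_sndD]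
  \<comment> \<open>If the total difference were a clique, the flips of the second component along
    the two sides would add up to those of this single clique.\<close>
  have "\<not> indep N (sym_diff (fst p0) (fst p2))"
  proof
    assume ind: "indep N (sym_diff (fst p0) (fst p2))"
    have "((a, x) \<in> snd p0) \<noteq> ((a, x) \<in> snd p2) \<longleftrightarrow>
        a \<in> sym_diff (fst p0) (fst p2) \<and> x \<in> fst p0 \<and> N a x" for a x
      using c(1,2)[of a x] i(1,2)[of a x] ind unfolding indep_def by blast
    then show False using ind assms(6) unfolding linked_def by blast
  qed
  then obtain a b where ab: "N a b" "a \<in> sym_diff (fst p0) (fst p2)" "b \<in> sym_diff (fst p0) (fst p2)"
    unfolding indep_def by blast
  have key: thesis if st: "N s t" "s \<in> sym_diff (fst p0) (fst p1)" "s \<notin> sym_diff (fst p1) (fst p2)"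
     "t \<in> sym_diff (fst p1) (fst p2)" "t \<notin> sym_diff (fst p0) (fst p1)" for s t
  proof (cases "s \<in> sym_diff (fst p3) (fst p0)")
    case True
    have "t \<in> sym_diff (fst p2) (fst p3)"
      using st True i(4)[of s t] by blast
    then show thesis by (intro outer[of s t] st True)
  next
    case False
    then have "s \<in> sym_diff (fst p2) (fst p3)" using st by blast
    moreover from this have "t \<notin> sym_diff (fst p2) (fst p3)" using i(3) st(1) by blast
    \<comment> \<open>The flips of the pair \<open>(s, t)\<close> do not cancel around the square:
      \<open>s\<close> changes on the sides \<open>p0 p1\<close> and \<open>p2 p3\<close> only, and
      \<open>t\<close> lies in exactly one of \<open>fst p0\<close> and
      \<open>fst p2\<close>.\<close>
    ultimately show thesis
      using c[of s t] st False by blast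
  qed
  show thesis
  proof (cases "a \<in> sym_diff (fst p0) (fst p1)")
    case True
    then have "b \<notin> sym_diff (fst p0) (fst p1)" using i(1) ab by blast
    with True show thesis using ab by (intro key[of a b]) auto
  next
    case False
    then have a: "a \<in> sym_diff (fst p1) (fst p2)" using ab by blast
    then have "b \<notin> sym_diff (fst p1) (fst p2)" using i(2) ab by blast
    with a False show thesis using ab sym by (intro key[of b a]) auto
  qed
qed

lemma gap_free_not_linked:
  assumes "symp N" "gap_free N"
  shows "gap_free (\<lambda>p q. \<not> linked N p q)"
  unfolding gap_free_def
proof (intro allI impI, elim conjE, rule ccontr)
  fix p0 p2 p1 p3
  assume n: "\<not> linked N p0 p2" "\<not> linked N p1 p3"
    and "\<not> (\<not> linked N p0 p1 \<or> \<not> linked N p0 p3 \<or> \<not> linked N p2 p1 \<or> \<not> linked N p2 p3)"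
  then have l: "linked N p0 p1" "linked N p1 p2" "linked N p2 p3" "linked N p3 p0" using linked_sym by blast+
  obtain s t where st: "N s t"
    "s \<in> sym_diff (fst p0) (fst p1)" "s \<in> sym_diff (fst p3) (fst p0)"
    "t \<in> sym_diff (fst p1) (fst p2)" "t \<in> sym_diff (fst p2) (fst p3)"
    using linked_square_half[OF assms(1) l n(1)] .
  obtain s' t' where st': "N s' t'"
    "s' \<in> sym_diff (fst p1) (fst p2)" "s' \<in> sym_diff (fst p0) (fst p1)"
    "t' \<in> sym_diff (fst p2) (fst p3)" "t' \<in> sym_diff (fst p3) (fst p0)"
    using linked_square_half[OF assms(1) l(2,3,4,1) n(2)] .
  \<comment> \<open>One of these mixed pairs is non-adjacent in the old graph, but the two members
    of each mixed pair are used together along some side, hence belong to a common clique.\<close>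
  have "N s s' \<or> N s t' \<or> N t s' \<or> N t t'"
    by (rule assms(2)[unfolded gap_free_def, rule_format]) (intro conjI st(1) st'(1))
  then show False
    using linked_indepD[OF l(1) st(2) st'(3)] linked_indepD[OF l(4) st(3) st'(5)]
      linked_indepD[OF l(2) st(4) st'(2)] linked_indepD[OF l(3) st(5) st'(4)] by blast
qed

section \<open>Orderings of faces, their signs and prefixes\<close>

fun list_sign :: "nat list \<Rightarrow> 'k::field" where
  "list_sign [] = 1"
| "list_sign (x # xs) = psgn (set xs) x * list_sign xs"

lemma list_sign_swap:
  "distinct (xs @ a # b # ys) \<Longrightarrow> list_sign (xs @ b # a # ys) = - (list_sign (xs @ a # b # ys) :: 'k::field)"
proof (induction xs)
  case Nil
  then have "psgn (set ys) a * psgn (insert a (set ys)) b = - (psgn (set ys) b * psgn (insert b (set ys)) a :: 'k)"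
    by (intro psgn_swap) auto
  then show ?case by (simp add: algebra_simps)
next
  case (Cons x xs)
  then have "list_sign (xs @ b # a # ys) = - (list_sign (xs @ a # b # ys) :: 'k)" by simp
  moreover have "set (xs @ b # a # ys) = set (xs @ a # b # ys)" by auto
  ultimately show ?case by (simp only: append_Cons list_sign.simps mult_minus_right)
qed

text \<open>The factor \<open>psgn (set t) b * list_sign t\<close> is the sign of
  \<open>b # t\<close>, and moving \<open>b\<close> from the end to the front passes
  \<open>length t\<close> entries.\<close>

lemma list_sign_snoc:
  "distinct (t @ [b]) \<Longrightarrow> list_sign (t @ [b]) = (-1) ^ length t * (psgn (set t) b * list_sign t :: 'k::field)"
proof (induction t)
  case (Cons x t)
  then show ?case using psgn_swap[of "set t" x b, where 'k='k]
    by (simp add: algebra_simps)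
qed (simp add: psgn_def)

lemma list_sign_sorted: "sorted_wrt (<) t \<Longrightarrow> list_sign t = (1 :: 'k::field)"
proof (induction t)
  case (Cons x t)
  then have *: "{u \<in> set t. u < x} = {}" by auto
  then have "psgn (set t) x = (1 :: 'k)" unfolding psgn_def * by simp
  then show ?case using Cons by simp
qed simp

text \<open>The predicate \<open>Q\<close> selects one member of each pair swapped by the
  involution. This also covers characteristic 2, where a sum equal to its own negative need not
  vanish.\<close>

lemma sum_sign_involution:
  fixes f :: "'a \<Rightarrow> 'k::field"
  assumes "finite P"
    and "\<And>p. p \<in> P \<Longrightarrow> \<iota> p \<in> P \<and> \<iota> (\<iota> p) = p \<and> f (\<iota> p) = - f p \<and> (Q (\<iota> p) \<longleftrightarrow> \<not> Q p)"
  shows "sum f P = 0"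
proof -
  have "sum f P = sum f {p\<in>P. Q p} + sum f {p\<in>P. \<not> Q p}"
    using sum.Int_Diff[OF assms(1), of f "Collect Q"] by (simp add: Int_def set_diff_eq)
  also have "sum f {p\<in>P. \<not> Q p} = sum (\<lambda>p. - f p) {p\<in>P. Q p}"
    by (rule sum.reindex_bij_witness[of _ \<iota> \<iota>]) (use assms(2) in auto)
  finally show ?thesis by (simp add: sum_negf)
qed

lemma Max_prefix_sorted:
  fixes t :: "nat list"
  assumes "sorted_wrt (<) t" "j < length t"
  shows "Max (set (take (Suc j) t)) = t ! j"
proof (rule Max_eqI)
  fix y assume "y \<in> set (take (Suc j) t)"
  then obtain k where "k \<le> j" "y = t ! k" using assms(2) by (fastforce simp: in_set_conv_nth less_Suc_eq_le)
  then show "y \<le> t ! j" using assms by (cases "k = j") (auto simp: sorted_wrt_iff_nth_less less_imp_le)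
qed (use assms(2) in \<open>auto simp: in_set_conv_nth\<close>)

lemma image_Max_prefix:
  fixes t :: "nat list"
  assumes "sorted_wrt (<) t"
  shows "(\<lambda>i. Max (set (take i t))) ` {1..length t} = set t"
proof -
  have "(\<lambda>i. Max (set (take i t))) ` {1..length t} = (\<lambda>i. Max (set (take i t))) ` Suc ` {..<length t}"
    by (simp add: image_Suc_lessThan)
  also have "\<dots> = (\<lambda>j. t ! j) ` {..<length t}"
    unfolding image_image by (rule image_cong) (simp_all add: Max_prefix_sorted assms)
  finally show ?thesis by (simp add: set_conv_nth image_def lessThan_def) blast
qed

text \<open>Distinct prefix maxima force every entry to exceed all earlier ones. This later singles
  out one ordering of each face.\<close>

lemma inj_on_Max_prefix_iff:
  fixes t :: "nat list"
  shows "inj_on (\<lambda>i. Max (set (take i t))) {1..length t} \<longleftrightarrow> sorted_wrt (<) t" (is "?l \<longleftrightarrow> ?r")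
proof
  assume ?r
  then show ?l
    by (intro eq_card_imp_inj_on)
      (simp_all only: image_Max_prefix finite_atLeastAtMost card_atLeastAtMost diff_Suc_1
        distinct_card strict_sorted_iff)
next
  assume ?l
  then show ?r
  proof (induction t rule: rev_induct)
    case (snoc b t)
    have "inj_on (\<lambda>i. Max (set (take i (t @ [b])))) {1..length t}"
      using snoc.prems by (rule inj_on_subset) auto
    then have "inj_on (\<lambda>i. Max (set (take i t))) {1..length t}"
      by (rule inj_on_cong[THEN iffD1, rotated]) simp
    then have s: "sorted_wrt (<) t" using snoc.IH by blast
    have "x < b" if x: "x \<in> set t" for x
    proof -
      have "length t \<in> {1..length (t @ [b])}" "Suc (length t) \<in> {1..length (t @ [b])}"
        using x by (cases t; auto)+
      from inj_on_contraD[OF snoc.prems _ this] have "Max (set t) \<noteq> Max (insert b (set t))" by simp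
      then have "Max (set t) < b"
        using x Max_insert[of "set t" b] by (fastforce simp: max_def split: if_splits)
      then show ?thesis using x by (meson List.finite_set Max_ge le_less_trans)
    qed
    then show ?case using s by (simp add: sorted_wrt_append)
  qed simp
qed

lemma set_encode_strict_mono:
  assumes "finite B" "A \<subset> B" shows "set_encode A < set_encode B"
proof -
  obtain b where "b \<in> B - A" using assms by blast
  then show ?thesis unfolding set_encode_def using assms
    by (intro sum_strict_mono2[of B A b]) auto
qed

text \<open>Sets are coded in binary, so the maximum of a set is the position of the leading bit of
  its code.\<close>

lemma Max_le_if_set_encode_le:
  assumes "finite A" "A \<noteq> {}" "finite B" "B \<noteq> {}" "set_encode A \<le> set_encode B"
  shows "Max A \<le> Max B"
proof (rule ccontr)
  assume "\<not> Max A \<le> Max B"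
  then have lt: "Suc (Max B) \<le> Max A" by simp
  have "B \<subseteq> {..<Suc (Max B)}" using assms Max_ge le_imp_less_Suc by blast
  then have "set_encode B \<le> sum ((^) 2) {..<Suc (Max B)}"
    unfolding set_encode_def by (intro sum_mono2) auto
  also have "\<dots> < 2 ^ Suc (Max B)"
    using sum_power2[of "Suc (Max B)"] by (simp add: atLeast0LessThan lessThan_Suc_atMost[symmetric])
  also have "\<dots> \<le> 2 ^ Max A" using lt by (intro power_increasing) auto
  also have "\<dots> = set_encode {Max A}" by simp
  also have "\<dots> \<le> set_encode A"
    unfolding set_encode_def using assms by (intro sum_mono2) auto
  finally show False using assms(5) by simp
qed

text \<open>If \<open>r\<close> identifies exactly two vertices of \<open>F\<close>, these are consecutive by monotonicity, so the
  only two nonzero terms cancel.\<close>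
lemma pull_cocycle:
  fixes \<phi> :: "nat set \<Rightarrow> 'k::field"
  assumes fin: "finite F"
    and mono: "\<And>x y. x \<in> F \<Longrightarrow> y \<in> F \<Longrightarrow> x < y \<Longrightarrow> r x \<le> r y"
    and coc: "inj_on r F \<Longrightarrow> (\<Sum>u\<in>r ` F. psgn (r ` F) u * \<phi> (r ` F - {u})) = 0"
  shows "(\<Sum>x\<in>F. psgn F x * (if inj_on r (F - {x}) then \<phi> (r ` (F - {x})) else 0)) = 0"
proof (cases "inj_on r F")
  case True
  have "psgn F x = psgn (r ` F) (r x)" if "x \<in> F" for x
  proof -
    have *: "r y < r x \<longleftrightarrow> y < x" if "y \<in> F" for y
      using mono[of x y] mono[of y x] True that \<open>x \<in> F\<close> unfolding inj_on_def
      by (metis linorder_neqE_nat nless_le not_le)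
    have "{u \<in> r ` F. u < r x} = r ` {y \<in> F. y < x}" using * by auto
    moreover have "inj_on r {y \<in> F. y < x}" using True by (rule inj_on_subset) auto
    ultimately show ?thesis by (simp add: psgn_def card_image)
  qed
  moreover have "inj_on r (F - {x})" for x using True by (rule inj_on_subset) auto
  moreover have "r ` (F - {x}) = r ` F - {r x}" if "x \<in> F" for x
    using True that by (auto simp: inj_on_def)
  ultimately have "(\<Sum>x\<in>F. psgn F x * (if inj_on r (F - {x}) then \<phi> (r ` (F - {x})) else 0))
    = (\<Sum>x\<in>F. psgn (r ` F) (r x) * \<phi> (r ` F - {r x}))"
    by (intro sum.cong) auto
  also have "\<dots> = (\<Sum>u\<in>r ` F. psgn (r ` F) u * \<phi> (r ` F - {u}))"
    using True by (simp add: sum.reindex)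
  finally show ?thesis using coc[OF True] by simp
next
  case False
  then obtain x y where xy: "x \<in> F" "y \<in> F" "x < y" "r x = r y"
    unfolding inj_on_def by (metis linorder_neqE_nat)
  let ?f = "\<lambda>x. psgn F x * (if inj_on r (F - {x}) then \<phi> (r ` (F - {x})) else 0)"
  have "?f w = 0" if "w \<in> F - {x, y}" for w
    using xy that by (auto simp: inj_on_def)
  then have "sum ?f F = sum ?f {x, y}"
    using fin xy by (intro sum.mono_neutral_right) auto
  also have "\<dots> = ?f x + ?f y" using xy by simp
  also have "\<dots> = 0"
  proof (cases "inj_on r (F - {x})")
    case True
    have i: "r ` (F - {x}) = r ` (F - {y})"
      using xy by (auto simp: image_iff) (metis insertE insert_Diff)+
    have "inj_on r (F - {y})"
      using True xy unfolding inj_on_def by (metis (no_types, lifting) Diff_iff insertE insertI1 singletonD)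
    have "{u \<in> F. u < y} = insert x {u \<in> F. u < x}"
    proof (intro equalityI subsetI)
      fix u assume u: "u \<in> {u \<in> F. u < y}"
      have "\<not> x < u"
      proof
        assume "x < u"
        have uF: "u \<in> F" "u < y" using u by simp_all
        have "r x \<le> r u" "r u \<le> r y" using mono[of x u] mono[of u y] uF xy(1,2) \<open>x < u\<close> by blast+
        then have "r u = r y" using xy(4) by linarith
        moreover have "u \<in> F - {x}" "y \<in> F - {x}" using uF xy(2,3) \<open>x < u\<close> by simp_all
        ultimately have "u = y" using inj_onD[OF True] by blast
        then show False using uF by simp
      qed
      then show "u \<in> insert x {u \<in> F. u < x}" using u by auto
    qed (use xy in auto)
    then have "psgn F y = - (psgn F x :: 'k)" using fin by (simp add: psgn_def)
    then show ?thesis using i True \<open>inj_on r (F - {y})\<close> by simp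
  next
    case F: False
    have "\<not> inj_on r (F - {y})"
      using F xy unfolding inj_on_def by (metis (no_types, lifting) Diff_iff insertE insertI1 singletonD)
    then show ?thesis using F by simp
  qed
  finally show ?thesis .
qed

lemma bdry_sum: "bdry S (\<lambda>F. \<Sum>p\<in>P. g p F) G = (\<Sum>p\<in>P. bdry S (g p) G)"
  unfolding bdry_def sum_distrib_left by (rule sum.swap)

text \<open>As \<open>f\<close> is increasing, the vertex \<open>f i\<close> has exactly
  \<open>i\<close> predecessors in the simplex, which gives the sign
  \<open>(-1) ^ i\<close>.\<close>

lemma bdry_indicator:
  fixes f :: "nat \<Rightarrow> nat" and a :: "'k::field"
  assumes fin: "finite S" and less: "\<And>i j. i < j \<Longrightarrow> j \<le> n \<Longrightarrow> f i < f j" and sub: "f ` {..n} \<subseteq> S"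
  shows "bdry S (\<lambda>F. if F = f ` {..n} then a else 0) G =
    (\<Sum>i\<le>n. (-1) ^ i * (if G = f ` ({..n} - {i}) then a else 0))"
proof -
  let ?F = "f ` {..n}"
  have inj: "inj_on f {..n}"
    by (rule linorder_inj_onI) (use less in \<open>fastforce+\<close>)
  have "bdry S (\<lambda>F. if F = ?F then a else 0) G =
    (\<Sum>v\<in>?F. if G = ?F - {v} then psgn (?F - {v}) v * a else 0)"
    unfolding bdry_def
  proof (rule sum.mono_neutral_cong)
    fix v assume "v \<in> ?F - (S - G)"
    then have "v \<in> G" using sub by blast
    then show "(if G = ?F - {v} then psgn (?F - {v}) v * a else 0) = 0" by auto
  next
    fix v assume "v \<in> S - G - ?F"
    then have "insert v G \<noteq> ?F" by blast
    then show "psgn G v * (if insert v G = ?F then a else 0) = 0" by simp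
  next
    fix v assume "v \<in> (S - G) \<inter> ?F"
    then have "insert v G = ?F \<longleftrightarrow> G = ?F - {v}" by blast
    then show "psgn G v * (if insert v G = ?F then a else 0) =
        (if G = ?F - {v} then psgn (?F - {v}) v * a else 0)" by simp
  qed (use fin in auto)
  also have "\<dots> = (\<Sum>i\<le>n. if G = ?F - {f i} then psgn (?F - {f i}) (f i) * a else 0)"
    by (simp add: sum.reindex[OF inj])
  also have "\<dots> = (\<Sum>i\<le>n. (-1) ^ i * (if G = f ` ({..n} - {i}) then a else 0))"
  proof (rule sum.cong)
    fix i assume i: "i \<in> {..n}"
    have "?F - {f i} = f ` ({..n} - {i})"
      using inj_on_image_set_diff[OF inj, of "{..n}" "{i}"] i by simp
    moreover have "{u \<in> ?F - {f i}. u < f i} = f ` {..<i}"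
    proof (intro equalityI subsetI)
      fix u assume "u \<in> {u \<in> ?F - {f i}. u < f i}"
      then obtain j where j: "j \<le> n" "u = f j" "f j < f i" by auto
      have "j < i" using less[of i j] j by (cases j i rule: linorder_cases) auto
      then show "u \<in> f ` {..<i}" using j by simp
    next
      fix u assume "u \<in> f ` {..<i}"
      then obtain j where "j < i" "u = f j" by auto
      then show "u \<in> {u \<in> ?F - {f i}. u < f i}" using less[of j i] i by auto
    qed
    moreover have "card (f ` {..<i}) = i"
      using inj_on_subset[OF inj, of "{..<i}"] i by (simp add: card_image subset_iff)
    ultimately show "(if G = ?F - {f i} then psgn (?F - {f i}) (f i) * a else 0) =
      (-1) ^ i * (if G = f ` ({..n} - {i}) then a else 0)"
      by (simp add: psgn_def)
  qed simp
  finally show ?thesis .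
qed

definition swap_at :: "nat \<Rightarrow> 'a list \<Rightarrow> 'a list" where
  "swap_at k t = t[k := t ! Suc k, Suc k := t ! k]"

lemma swap_at_append: "swap_at (length xs) (xs @ a # b # ys) = xs @ b # a # ys"
  by (simp add: swap_at_def list_update_append nth_append)

lemma split_at_two:
  assumes "Suc k < length t"
  obtains xs a b ys where "t = xs @ a # b # ys" "length xs = k"
proof -
  have "t = take k t @ t ! k # t ! Suc k # drop (Suc (Suc k)) t"
    using assms id_take_nth_drop[of k t] Cons_nth_drop_Suc[of "Suc k" t] by simp
  then show thesis using that[of "take k t"] assms by simp
qed

text \<open>By the last claim only the prefix of length \<open>Suc k\<close> notices the swap, so
  the two corresponding paths in a cube share all vertices but one.\<close>

lemma swap_at_props:
  fixes t :: "nat list"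
  assumes "Suc k < length t" "distinct t"
  shows "swap_at k (swap_at k t) = t" "set (swap_at k t) = set t" "length (swap_at k t) = length t"
    "distinct (swap_at k t)" "list_sign (swap_at k t) = - (list_sign t :: 'k::field)"
    "swap_at k t ! k < swap_at k t ! Suc k \<longleftrightarrow> \<not> t ! k < t ! Suc k"
    "j \<noteq> Suc k \<Longrightarrow> set (take j (swap_at k t)) = set (take j t)"
proof -
  obtain xs a b ys where t: "t = xs @ a # b # ys" and k: "k = length xs"
    using split_at_two[OF assms(1)] by metis
  have s: "swap_at k t = xs @ b # a # ys" by (simp add: t k swap_at_append)
  show "swap_at k (swap_at k t) = t" unfolding s k swap_at_append t ..
  show "set (swap_at k t) = set t" "length (swap_at k t) = length t" "distinct (swap_at k t)"
    unfolding s using assms(2) by (auto simp: t)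
  show "list_sign (swap_at k t) = - (list_sign t :: 'k)" unfolding s using assms(2) unfolding t by (rule list_sign_swap)
  show "swap_at k t ! k < swap_at k t ! Suc k \<longleftrightarrow> \<not> t ! k < t ! Suc k"
    unfolding s using assms(2) by (auto simp: t k nth_append)
  assume "j \<noteq> Suc k"
  then consider "j \<le> length xs" | i where "j = length xs + Suc (Suc i)"
    using k by (metis add.commute add_Suc_right le_antisym less_eq_Suc_le nat_le_linear not_less_eq_eq
        le_Suc_ex add_Suc)
  then show "set (take j (swap_at k t)) = set (take j t)"
    unfolding s by cases (auto simp: t)
qed

text \<open>The order of the new vertices given by the encoding \<open>e\<close> refines inclusion of the first components
  (needed for the signs in the cycle) and makes \<open>p \<mapsto> Max (fst p)\<close> monotone (needed for the cocycle).\<close>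
locale doubling =
  fixes S :: "nat set" and N :: "nat \<Rightarrow> nat \<Rightarrow> bool" and m :: nat
    and z \<phi> :: "nat set \<Rightarrow> 'k::field" and e :: "vert \<Rightarrow> nat"
  assumes finS: "finite S" and irrN: "irreflp N" and m: "0 < m"
    and z: "\<And>F. z F \<noteq> 0 \<Longrightarrow> F \<subseteq> S \<and> indep N F \<and> card F = m"
    and cycle: "\<And>G. bdry S z G = 0"
    and cocycle: "\<And>F. F \<subseteq> S \<Longrightarrow> indep N F \<Longrightarrow> card F = Suc m \<Longrightarrow>
      (\<Sum>v\<in>F. psgn F v * \<phi> (F - {v})) = 0"
    and e_inj: "inj_on e (Pow S \<times> Pow (S \<times> S))"
    and e_less: "\<And>p q. p \<in> Pow S \<times> Pow (S \<times> S) \<Longrightarrow> q \<in> Pow S \<times> Pow (S \<times> S) \<Longrightarrow>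
      set_encode (fst p) < set_encode (fst q) \<Longrightarrow> e p < e q"
begin

section \<open>Flags of cubes and the chain \<open>Z\<close>\<close>

definition \<Omega> :: "vert set" where "\<Omega> = Pow S \<times> Pow (S \<times> S)"

definition act :: "vert \<Rightarrow> nat set \<Rightarrow> vert" where
  "act p \<sigma> = (sym_diff (fst p) \<sigma>, sym_diff (snd p) {(a, x). a \<in> \<sigma> \<and> x \<in> fst p \<and> N a x})"

definition vx :: "vert \<Rightarrow> nat list \<Rightarrow> nat \<Rightarrow> nat" where
  "vx p t i = e (act p (set (take i t)))"

text \<open>A flag \<open>(p, t)\<close> is the path from \<open>p\<close> along the directions \<open>t\<close>. Requiring \<open>t\<close> disjoint from
  \<open>fst p\<close> picks one starting corner in each cube, so that every cube is triangulated just once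
  (otherwise the class would be multiplied by a power of 2).\<close>
definition flags :: "nat \<Rightarrow> (vert \<times> nat list) set" where
  "flags k = {(p, t). p \<in> \<Omega> \<and> length t = k \<and> distinct t \<and> set t \<subseteq> S - fst p}"

definition cube_flags :: "(vert \<times> nat list) set" where
  "cube_flags = {(p, t). (p, t) \<in> flags m \<and> indep N (set t)}"

text \<open>The parity of the starting corner alternates between neighbouring corners,
  \<open>list_sign\<close> orients the simplices inside one cube, and \<open>z\<close> weights the
  cube by the face of the old cycle that spans it.\<close>

definition weight :: "vert \<Rightarrow> nat list \<Rightarrow> 'k" where
  "weight p t = (-1) ^ card (fst p) * (list_sign t * z (set t))"

definition Z :: "nat set \<Rightarrow> 'k" where
  "Z F = (\<Sum>(p, t)\<in>cube_flags. if F = vx p t ` {..m} then weight p t else 0)"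

definition face_sum :: "nat \<Rightarrow> nat set \<Rightarrow> 'k" where
  "face_sum i G = (\<Sum>(p, t)\<in>cube_flags. if G = vx p t ` ({..m} - {i}) then weight p t else 0)"

lemma finite_\<Omega>: "finite \<Omega>" using finS by (simp add: \<Omega>_def)

lemma e_inj': "inj_on e \<Omega>" using e_inj by (simp add: \<Omega>_def)

lemma e_less': "p \<in> \<Omega> \<Longrightarrow> q \<in> \<Omega> \<Longrightarrow> set_encode (fst p) < set_encode (fst q) \<Longrightarrow> e p < e q"
  using e_less by (simp add: \<Omega>_def)

lemma finite_flags: "finite (flags k)"
proof (rule finite_subset)
  show "flags k \<subseteq> \<Omega> \<times> {t. set t \<subseteq> S \<and> length t = k}" by (auto simp: flags_def)
qed (use finite_\<Omega> finS finite_lists_length_eq in auto)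

lemma finite_cube_flags: "finite cube_flags"
  by (rule finite_subset[OF _ finite_flags[of m]]) (auto simp: cube_flags_def)

lemma act_in: "p \<in> \<Omega> \<Longrightarrow> \<sigma> \<subseteq> S \<Longrightarrow> act p \<sigma> \<in> \<Omega>"
  by (auto simp: \<Omega>_def act_def)

text \<open>Inside a clique no \<open>a\<close> in \<open>\<tau>\<close> and \<open>x\<close> in
  \<open>\<sigma>\<close> satisfy \<open>N a x\<close>, so multiplying by \<open>\<sigma>\<close>
  first does not change the flips caused by \<open>\<tau>\<close>.\<close>

lemma act_act:
  assumes "\<sigma> \<inter> \<tau> = {}" "indep N (\<sigma> \<union> \<tau>)"
  shows "act (act p \<sigma>) \<tau> = act p (\<sigma> \<union> \<tau>)"
proof (rule prod_eqI)
  show "fst (act (act p \<sigma>) \<tau>) = fst (act p (\<sigma> \<union> \<tau>))"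
    using assms(1) unfolding act_def by auto
  have *: "a \<in> \<tau> \<Longrightarrow> x \<in> \<sigma> \<Longrightarrow> \<not> N a x" for a x using assms(2) by (auto simp: indep_def)
  show "snd (act (act p \<sigma>) \<tau>) = snd (act p (\<sigma> \<union> \<tau>))"
  proof (rule set_eqI, clarify)
    fix a x
    show "(a, x) \<in> snd (act (act p \<sigma>) \<tau>) \<longleftrightarrow> (a, x) \<in> snd (act p (\<sigma> \<union> \<tau>))"
      using assms(1) *[of a x] by (cases "a \<in> \<tau>"; cases "x \<in> \<sigma>") (auto simp: act_def)
  qed
qed

lemma linked_act: "indep N \<sigma> \<Longrightarrow> linked N p (act p \<sigma>)"
proof -
  assume "indep N \<sigma>"
  moreover have "sym_diff (fst p) (fst (act p \<sigma>)) = \<sigma>" by (auto simp: act_def)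
  moreover have "((a, x) \<in> snd p) \<noteq> ((a, x) \<in> snd (act p \<sigma>)) \<longleftrightarrow> a \<in> \<sigma> \<and> x \<in> fst p \<and> N a x" for a x
    by (cases "(a, x) \<in> snd p") (auto simp: act_def)
  ultimately show ?thesis unfolding linked_def by simp
qed

lemma linked_act_act:
  assumes "\<sigma> \<subseteq> \<tau>" "indep N \<tau>"
  shows "linked N (act p \<sigma>) (act p \<tau>)"
proof -
  have "act p \<tau> = act (act p \<sigma>) (\<tau> - \<sigma>)"
    using assms act_act[of \<sigma> "\<tau> - \<sigma>" p] by (simp add: Un_absorb1)
  moreover have "indep N (\<tau> - \<sigma>)" using assms by (auto simp: indep_def)
  ultimately show ?thesis using linked_act by simp
qed

text \<open>The directions of a flag avoid \<open>fst p\<close>, so the first components grow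
  strictly along the path, and the encoding respects inclusion.\<close>

lemma vx_less:
  assumes "(p, t) \<in> flags k" "i < j" "j \<le> k"
  shows "vx p t i < vx p t j"
proof -
  have t: "p \<in> \<Omega>" "length t = k" "distinct t" "set t \<subseteq> S - fst p" using assms by (auto simp: flags_def)
  have sub: "set (take l t) \<subseteq> S - fst p" for l using t(4) set_take_subset[of l t] by (rule order.trans[rotated])
  have f: "fst (act p (set (take l t))) = fst p \<union> set (take l t)" for l
    using sub[of l] by (auto simp: act_def)
  have "t ! i \<notin> set (take i t)"
    using t assms by (auto simp: in_set_conv_nth nth_eq_iff_index_eq)
  moreover have "t ! i \<in> set (take j t)" using t assms by (auto simp: in_set_conv_nth)
  moreover have "set (take i t) \<subseteq> set (take j t)" using assms set_take_subset_set_take[of i j t] by simp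
  ultimately have "fst p \<union> set (take i t) \<subset> fst p \<union> set (take j t)"
    using sub[of j] by blast
  moreover have "finite (fst p \<union> set (take j t))"
    using t(1) finS finite_subset by (auto simp: \<Omega>_def)
  ultimately show ?thesis
    unfolding vx_def using t(1) sub by (intro e_less' act_in) (auto simp: f intro!: set_encode_strict_mono)
qed

lemma vx_in: "(p, t) \<in> flags k \<Longrightarrow> vx p t i \<in> e ` \<Omega>"
  unfolding vx_def flags_def using set_take_subset[of i t] by (auto intro!: imageI act_in)

section \<open>The chain \<open>Z\<close> is a cycle\<close>

lemma bdry_Z: "bdry (e ` \<Omega>) Z G = (\<Sum>i\<le>m. (-1) ^ i * face_sum i G)"
proof -
  have "bdry (e ` \<Omega>) Z G = (\<Sum>(p, t)\<in>cube_flags. \<Sum>i\<le>m. (-1) ^ i * (if G = vx p t ` ({..m} - {i}) then weight p t else 0))"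
    unfolding Z_def case_prod_beta bdry_sum
  proof (rule sum.cong)
    fix x assume "x \<in> cube_flags"
    then have x: "(fst x, snd x) \<in> flags m" by (auto simp: cube_flags_def)
    show "bdry (e ` \<Omega>) (\<lambda>F. if F = vx (fst x) (snd x) ` {..m} then weight (fst x) (snd x) else 0) G =
      (\<Sum>i\<le>m. (-1) ^ i * (if G = vx (fst x) (snd x) ` ({..m} - {i}) then weight (fst x) (snd x) else 0))"
      using vx_less[OF x] vx_in[OF x] finite_\<Omega> by (intro bdry_indicator) auto
  qed simp
  also have "\<dots> = (\<Sum>i\<le>m. (-1) ^ i * face_sum i G)"
    unfolding face_sum_def case_prod_beta sum_distrib_left by (rule sum.swap)
  finally show ?thesis .
qed

text \<open>Exchanging the directions \<open>k\<close> and \<open>Suc k\<close> moves only the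
  vertex that the face omits and reverses the sign, so the faces cancel in pairs.\<close>

lemma face_sum_middle:
  assumes "Suc k < m"
  shows "face_sum (Suc k) G = 0"
  unfolding face_sum_def
proof (rule sum_sign_involution[where \<iota> = "\<lambda>(p, t). (p, swap_at k t)" and Q = "\<lambda>(p, t). t ! k < t ! Suc k"])
  fix x assume "x \<in> cube_flags"
  then obtain p t where x: "x = (p, t)" and t: "p \<in> \<Omega>" "length t = m" "distinct t" "set t \<subseteq> S - fst p"
    "indep N (set t)" by (cases x) (auto simp: cube_flags_def flags_def)
  have l: "Suc k < length t" using assms t by simp
  note sw = swap_at_props[OF l t(3)]
  have "vx p (swap_at k t) ` ({..m} - {Suc k}) = vx p t ` ({..m} - {Suc k})"
    by (rule image_cong) (auto simp: vx_def sw(7))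
  moreover have "weight p (swap_at k t) = - weight p t" by (simp add: weight_def sw(2,5))
  moreover have "(p, swap_at k t) \<in> cube_flags" using t by (simp add: cube_flags_def flags_def sw)
  ultimately show "(case x of (p, t) \<Rightarrow> (p, swap_at k t)) \<in> cube_flags \<and>
      (case (case x of (p, t) \<Rightarrow> (p, swap_at k t)) of (p, t) \<Rightarrow> (p, swap_at k t)) = x \<and>
      (case (case x of (p, t) \<Rightarrow> (p, swap_at k t)) of (p, t) \<Rightarrow> if G = vx p t ` ({..m} - {Suc k}) then weight p t else 0) =
      - (case x of (p, t) \<Rightarrow> if G = vx p t ` ({..m} - {Suc k}) then weight p t else 0) \<and>
      (case (case x of (p, t) \<Rightarrow> (p, swap_at k t)) of (p, t) \<Rightarrow> t ! k < t ! Suc k) =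
      (\<not> (case x of (p, t) \<Rightarrow> t ! k < t ! Suc k))"
    by (simp add: x sw(1,6))
qed (rule finite_cube_flags)

definition ext_verts :: "nat list \<Rightarrow> nat set" where
  "ext_verts t = {b \<in> S - set t. indep N (insert b (set t))}"

text \<open>A common form for the terms of the first and the last faces: a path
  \<open>(q, t)\<close> with \<open>m\<close> vertices together with the direction \<open>b\<close>
  missing from it.\<close>

definition end_weight :: "nat set \<Rightarrow> vert \<Rightarrow> nat list \<Rightarrow> nat \<Rightarrow> 'k" where
  "end_weight G q t b = (if G = vx q t ` {..<m} then (-1) ^ card (fst q) * (list_sign (b # t) * z (insert b (set t))) else 0)"

lemma fst_act_single: "b \<notin> fst p \<Longrightarrow> fst (act p {b}) = insert b (fst p)"
  by (auto simp: act_def)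

lemma fst_act_single': "b \<in> fst p \<Longrightarrow> fst (act p {b}) = fst p - {b}"
  by (auto simp: act_def)

lemma act_single_twice: "act (act p {b}) {b} = p"
proof (rule prod_eqI)
  have "\<not> N b b" using irrN by (simp add: irreflp_def irreflp_on_def)
  then show "snd (act (act p {b}) {b}) = snd p" "fst (act (act p {b}) {b}) = fst p"
    unfolding act_def by auto
qed

lemma vx_Cons:
  assumes "b \<notin> set t" "indep N (insert b (set t))"
  shows "vx p (b # t) (Suc j) = vx (act p {b}) t j"
proof -
  have "set (take j t) \<subseteq> set t" by (rule set_take_subset)
  then have "act (act p {b}) (set (take j t)) = act p ({b} \<union> set (take j t))"
    using assms by (intro act_act) (auto simp: indep_def)
  then show ?thesis by (simp add: vx_def)
qed

text \<open>Dropping the first vertex of \<open>(p, b # t)\<close> leaves the path \<open>t\<close>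
  from \<open>act p {b}\<close>, a corner containing \<open>b\<close>; the changed parity of the
  corner gives the minus sign.\<close>

lemma face_sum_first:
  "face_sum 0 G = (\<Sum>((q, t), b)\<in>(SIGMA (q, t):flags (m - 1). ext_verts t \<inter> fst q). - end_weight G q t b)"
  unfolding face_sum_def
proof (rule sum.reindex_bij_witness[where
    i = "\<lambda>((q, t), b). (act q {b}, b # t)" and j = "\<lambda>(p, t). ((act p {hd t}, tl t), hd t)"])
  fix x assume "x \<in> cube_flags"
  then obtain p t where x: "x = (p, t)" and t: "p \<in> \<Omega>" "length t = m" "distinct t" "set t \<subseteq> S - fst p"
    "indep N (set t)" by (cases x) (auto simp: cube_flags_def flags_def)
  obtain b s where bs: "t = b # s" using t(2) m by (cases t) auto
  have fp: "finite (fst p)" using t(1) finS finite_subset by (auto simp: \<Omega>_def)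
  show "(\<lambda>((q, t), b). (act q {b}, b # t)) (case x of (p, t) \<Rightarrow> ((act p {hd t}, tl t), hd t)) = x"
    by (simp add: x bs act_single_twice)
  have f: "fst (act p {b}) = insert b (fst p)" using t bs by (intro fst_act_single) auto
  have "act p {b} \<in> \<Omega>" using t bs by (intro act_in) auto
  then show "(case x of (p, t) \<Rightarrow> ((act p {hd t}, tl t), hd t)) \<in> (SIGMA (q, t):flags (m - 1). ext_verts t \<inter> fst q)"
    using t by (auto simp: x bs f flags_def ext_verts_def)
  have "{..m} - {0} = Suc ` {..<m}" using m by (auto simp: image_Suc_lessThan)
  then have "vx p t ` ({..m} - {0}) = vx (act p {b}) s ` {..<m}"
    using t bs by (simp add: image_image vx_Cons)
  moreover have "weight p t = - ((-1) ^ card (fst (act p {b})) * (list_sign (b # s) * z (insert b (set s))))"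
    using t bs fp by (simp add: weight_def f)
  ultimately show "(\<lambda>((q, t), b). - end_weight G q t b) (case x of (p, t) \<Rightarrow> ((act p {hd t}, tl t), hd t)) =
      (case x of (p, t) \<Rightarrow> if G = vx p t ` ({..m} - {0}) then weight p t else 0)"
    by (simp add: x end_weight_def bs)
next
  fix y assume "y \<in> (SIGMA (q, t):flags (m - 1). ext_verts t \<inter> fst q)"
  then obtain q t b where y: "y = ((q, t), b)" and t: "q \<in> \<Omega>" "length t = m - 1" "distinct t" "set t \<subseteq> S - fst q"
    "b \<in> fst q" "b \<in> S" "b \<notin> set t" "indep N (insert b (set t))" by (auto simp: flags_def ext_verts_def)
  show "(case (\<lambda>((q, t), b). (act q {b}, b # t)) y of (p, t) \<Rightarrow> ((act p {hd t}, tl t), hd t)) = y"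
    by (simp add: y act_single_twice)
  have "act q {b} \<in> \<Omega>" using t by (intro act_in) auto
  then show "(\<lambda>((q, t), b). (act q {b}, b # t)) y \<in> cube_flags"
    using t m by (auto simp: y cube_flags_def flags_def fst_act_single')
qed

text \<open>Dropping the last vertex of \<open>(q, t @ [b])\<close> leaves the path
  \<open>(q, t)\<close> with \<open>b\<close> outside \<open>fst q\<close>; the factor
  \<open>(-1) ^ (m - 1)\<close> comes from moving \<open>b\<close> to the front.\<close>

lemma face_sum_last:
  "face_sum m G = (-1) ^ (m - 1) * (\<Sum>((q, t), b)\<in>(SIGMA (q, t):flags (m - 1). ext_verts t - fst q). end_weight G q t b)"
  unfolding face_sum_def sum_distrib_left
proof (rule sum.reindex_bij_witness[where
    i = "\<lambda>((q, t), b). (q, t @ [b])" and j = "\<lambda>(p, t). ((p, butlast t), last t)"])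
  fix x assume "x \<in> cube_flags"
  then obtain p t where x: "x = (p, t)" and t: "p \<in> \<Omega>" "length t = m" "distinct t" "set t \<subseteq> S - fst p"
    "indep N (set t)" by (cases x) (auto simp: cube_flags_def flags_def)
  obtain b s where bs: "t = s @ [b]" using t(2) m by (cases t rule: rev_cases) auto
  show "(\<lambda>((q, t), b). (q, t @ [b])) (case x of (p, t) \<Rightarrow> ((p, butlast t), last t)) = x"
    by (simp add: x bs)
  show "(case x of (p, t) \<Rightarrow> ((p, butlast t), last t)) \<in> (SIGMA (q, t):flags (m - 1). ext_verts t - fst q)"
    using t by (auto simp: x bs flags_def ext_verts_def)
  have "{..m} - {m} = {..<m}" by auto
  moreover have "vx p t ` {..<m} = vx p s ` {..<m}"
    by (rule image_cong) (use t bs in \<open>auto simp: vx_def\<close>)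
  ultimately have "vx p t ` ({..m} - {m}) = vx p s ` {..<m}" by simp
  moreover have "weight p t = (-1) ^ (m - 1) * ((-1) ^ card (fst p) * (list_sign (b # s) * z (insert b (set s))))"
    using t bs list_sign_snoc[of s b, where 'k='k] by (auto simp: weight_def)
  ultimately show "(-1) ^ (m - 1) * (\<lambda>((q, t), b). end_weight G q t b) (case x of (p, t) \<Rightarrow> ((p, butlast t), last t)) =
      (case x of (p, t) \<Rightarrow> if G = vx p t ` ({..m} - {m}) then weight p t else 0)"
    by (simp add: x end_weight_def bs)
next
  fix y assume "y \<in> (SIGMA (q, t):flags (m - 1). ext_verts t - fst q)"
  then obtain q t b where y: "y = ((q, t), b)" and t: "q \<in> \<Omega>" "length t = m - 1" "distinct t" "set t \<subseteq> S - fst q"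
    "b \<notin> fst q" "b \<in> S" "b \<notin> set t" "indep N (insert b (set t))" by (auto simp: flags_def ext_verts_def)
  show "(case (\<lambda>((q, t), b). (q, t @ [b])) y of (p, t) \<Rightarrow> ((p, butlast t), last t)) = y"
    by (simp add: y)
  show "(\<lambda>((q, t), b). (q, t @ [b])) y \<in> cube_flags"
    using t m by (auto simp: y cube_flags_def flags_def)
qed

text \<open>Up to a factor independent of \<open>b\<close>, this is the coefficient at
  \<open>set t\<close> of the boundary of \<open>z\<close>.\<close>

lemma sum_ext_verts: "(\<Sum>b\<in>ext_verts t. end_weight G q t b) = 0"
proof (cases "G = vx q t ` {..<m}")
  case True
  have "(\<Sum>b\<in>ext_verts t. psgn (set t) b * z (insert b (set t))) = (\<Sum>b\<in>S - set t. psgn (set t) b * z (insert b (set t)))"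
  proof (rule sum.mono_neutral_left)
    show "\<forall>b\<in>S - set t - ext_verts t. psgn (set t) b * z (insert b (set t)) = 0"
      using z by (auto simp: ext_verts_def)
  qed (use finS in \<open>auto simp: ext_verts_def\<close>)
  also have "\<dots> = 0" using cycle[of "set t"] by (simp add: bdry_def)
  finally have *: "(\<Sum>b\<in>ext_verts t. psgn (set t) b * z (insert b (set t))) = 0" .
  have "(\<Sum>b\<in>ext_verts t. end_weight G q t b) =
    (\<Sum>b\<in>ext_verts t. ((-1) ^ card (fst q) * list_sign t) * (psgn (set t) b * z (insert b (set t))))"
    using True by (intro sum.cong) (auto simp: end_weight_def mult_ac)
  also have "\<dots> = 0" unfolding sum_distrib_left[symmetric] * by simp
  finally show ?thesis .
qed (simp add: end_weight_def)

text \<open>Only first and last faces remain. They account for the directions \<open>b\<close>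
  inside and outside \<open>fst q\<close> respectively, with the same sign, and so combine to the
  vanishing sums over all of \<open>ext_verts t\<close>.\<close>

lemma cycle_Z: "bdry (e ` \<Omega>) Z G = 0"
proof -
  have fin: "finite (ext_verts t \<inter> A)" "finite (ext_verts t - A)" for t A using finS by (auto simp: ext_verts_def)
  have e: "(\<Sum>b\<in>ext_verts t \<inter> A. end_weight G q t b) + (\<Sum>b\<in>ext_verts t - A. end_weight G q t b) = 0" for A q t
    using sum_ext_verts[of G q t] sum.Int_Diff[of "ext_verts t" "end_weight G q t" A] finS by (simp add: ext_verts_def)
  have "(\<Sum>i\<le>m. (-1) ^ i * face_sum i G) = (\<Sum>i\<in>{0, m}. (-1) ^ i * face_sum i G)"
  proof (rule sum.mono_neutral_right)
    show "\<forall>i\<in>{..m} - {0, m}. (-1) ^ i * face_sum i G = 0"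
    proof
      fix i assume "i \<in> {..m} - {0, m}"
      then obtain k where "i = Suc k" "Suc k < m" by (cases i) auto
      then show "(-1) ^ i * face_sum i G = 0" by (simp add: face_sum_middle)
    qed
  qed auto
  also have "\<dots> = face_sum 0 G + (-1) ^ m * face_sum m G" using m by simp
  also have "(-1) ^ m * face_sum m G = - (\<Sum>((q, t), b)\<in>(SIGMA (q, t):flags (m - 1). ext_verts t - fst q). end_weight G q t b)"
  proof -
    have "(-1) ^ m * (-1) ^ (m - 1) = (- 1 :: 'k)"
      using m by (cases m) (auto simp flip: power_mult_distrib)
    then show ?thesis unfolding face_sum_last by (simp flip: mult.assoc)
  qed
  also have "face_sum 0 G = - (\<Sum>((q, t), b)\<in>(SIGMA (q, t):flags (m - 1). ext_verts t \<inter> fst q). end_weight G q t b)"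
    unfolding face_sum_first case_prod_beta sum_negf ..
  also have "(\<Sum>((q, t), b)\<in>(SIGMA (q, t):flags (m - 1). ext_verts t \<inter> fst q). end_weight G q t b)
    = (\<Sum>y\<in>flags (m - 1). \<Sum>b\<in>ext_verts (snd y) \<inter> fst (fst y). end_weight G (fst y) (snd y) b)"
    by (subst sum.Sigma) (use finite_flags fin in \<open>auto simp: case_prod_unfold\<close>)
  also have "(\<Sum>((q, t), b)\<in>(SIGMA (q, t):flags (m - 1). ext_verts t - fst q). end_weight G q t b)
    = (\<Sum>y\<in>flags (m - 1). \<Sum>b\<in>ext_verts (snd y) - fst (fst y). end_weight G (fst y) (snd y) b)"
    by (subst sum.Sigma) (use finite_flags fin in \<open>auto simp: case_prod_unfold\<close>)
  also have "- (\<Sum>y\<in>flags (m - 1). \<Sum>b\<in>ext_verts (snd y) \<inter> fst (fst y). end_weight G (fst y) (snd y) b) +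
      - (\<Sum>y\<in>flags (m - 1). \<Sum>b\<in>ext_verts (snd y) - fst (fst y). end_weight G (fst y) (snd y) b) = 0"
    unfolding minus_add_distrib[symmetric] sum.distrib[symmetric] e by simp
  finally show ?thesis by (simp add: bdry_Z)
qed

section \<open>The new complex and its cocycle\<close>

definition dec :: "nat \<Rightarrow> vert" where "dec = inv_into \<Omega> e"

definition N' :: "nat \<Rightarrow> nat \<Rightarrow> bool" where
  "N' x y \<longleftrightarrow> \<not> linked N (dec x) (dec y)"

definition v0 :: nat where "v0 = e ({}, {})"

text \<open>On the link of \<open>v0\<close> this is the retraction onto the old complex.\<close>
definition r :: "nat \<Rightarrow> nat" where "r x = Max (fst (dec x))"

text \<open>On simplices through \<open>v0\<close> this is the pullback of \<open>\<phi>\<close>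
  along \<open>r\<close>, with value 0 where \<open>r\<close> is degenerate.\<close>

definition \<phi>' :: "nat set \<Rightarrow> 'k" where
  "\<phi>' F = (if v0 \<in> F \<and> inj_on r (F - {v0}) then \<phi> (r ` (F - {v0})) else 0)"

lemma dec_e: "p \<in> \<Omega> \<Longrightarrow> dec (e p) = p"
  unfolding dec_def by (rule inv_into_f_f[OF e_inj'])

lemma dec_in: "x \<in> e ` \<Omega> \<Longrightarrow> dec x \<in> \<Omega> \<and> e (dec x) = x"
  by (auto simp: dec_e)

lemma empty_in: "({}, {}) \<in> \<Omega>"
  by (simp add: \<Omega>_def)

lemma symp_N': "symp N'"
  unfolding N'_def by (rule sympI) (use linked_sym in blast)

lemma irreflp_N': "irreflp N'"
  unfolding N'_def by (rule irreflpI) (simp add: linked_refl)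

lemma dec_vx: "(p, t) \<in> flags k \<Longrightarrow> dec (vx p t i) = act p (set (take i t))"
  unfolding vx_def using set_take_subset[of i t] by (intro dec_e act_in) (auto simp: flags_def)

lemma Z_support:
  assumes "Z F \<noteq> 0"
  shows "F \<subseteq> e ` \<Omega> \<and> indep N' F \<and> card F = Suc m"
proof -
  obtain p t where pt: "(p, t) \<in> cube_flags" and F: "F = vx p t ` {..m}"
    using assms unfolding Z_def
    by (auto elim!: sum.not_neutral_contains_not_neutral split: if_splits)
  have P: "(p, t) \<in> flags m" and t: "indep N (set t)" using pt by (auto simp: cube_flags_def)
  have inj: "inj_on (vx p t) {..m}"
    by (rule linorder_inj_onI) (use vx_less[OF P] in \<open>fastforce+\<close>)
  have *: "linked N (dec (vx p t i)) (dec (vx p t j))" if "i \<le> j" for i j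
  proof -
    have "indep N (set (take j t))" using t set_take_subset[of j t] unfolding indep_def by blast
    then show ?thesis
      unfolding dec_vx[OF P] using that by (intro linked_act_act set_take_subset_set_take)
  qed
  have "linked N (dec (vx p t i)) (dec (vx p t j))" for i j
    using *[of i j] linked_sym[OF *[of j i]] by (cases "i \<le> j") auto
  then have "indep N' F" by (auto simp: F indep_def N'_def)
  then show ?thesis using vx_in[OF P] inj by (auto simp: F card_image)
qed

lemma cocycle_\<phi>':
  assumes F: "F \<subseteq> e ` \<Omega>" "indep N' F" "card F = Suc (Suc m)"
  shows "(\<Sum>x\<in>F. psgn F x * \<phi>' (F - {x})) = 0"
proof (cases "v0 \<in> F")
  case False
  then show ?thesis by (simp add: \<phi>'_def)
next
  case True
  define F0 where "F0 = F - {v0}"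
  have finF: "finite F" using F(3) card.infinite by force
  have F0: "finite F0" "card F0 = Suc m" "F = insert v0 F0" "v0 \<notin> F0"
    using finF F(3) True by (auto simp: F0_def)
  have d: "dec x \<in> \<Omega>" "e (dec x) = x" if "x \<in> F" for x using dec_in that F(1) by auto
  have dv0: "dec v0 = ({}, {})" by (simp add: v0_def dec_e empty_in)
  have l0: "linked N ({}, {}) (dec x)" if "x \<in> F" for x
    using F(2) that True dv0 unfolding indep_def N'_def by metis
  have ind: "indep N (fst (dec x))" if "x \<in> F" for x
    using l0[OF that] by (simp add: linked_def)
  have ne: "fst (dec x) \<noteq> {}" if "x \<in> F0" for x
  proof
    assume em: "fst (dec x) = {}"
    have x: "x \<in> F" "x \<noteq> v0" using that by (auto simp: F0_def)
    have "snd (dec x) = {}" using linked_sndD[OF l0[OF x(1)]] em by auto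
    then have "dec x = ({}, {})" using em by (simp add: prod_eqI)
    then show False using d(2)[OF x(1)] x(2) v0_def by simp
  qed
  have finx: "finite (fst (dec x))" "fst (dec x) \<subseteq> S" if "x \<in> F" for x
    using d(1)[OF that] finS finite_subset by (auto simp: \<Omega>_def)
  \<comment> \<open>As \<open>v0\<close> comes first, passing from \<open>F\<close> to
    \<open>F0\<close> multiplies all signs by the same factor -1.\<close>
  have v0_less: "v0 < x" if "x \<in> F0" for x
  proof -
    have x: "x \<in> F" using that by (auto simp: F0_def)
    have "set_encode {} < set_encode (fst (dec x))"
      using ne[OF that] finx(1)[OF x] by (intro set_encode_strict_mono) auto
    then have "e ({}, {}) < e (dec x)" using d(1)[OF x] empty_in by (intro e_less') auto
    then show ?thesis using d(2)[OF x] by (simp add: v0_def)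
  qed
  have mono: "r x \<le> r y" if xy: "x \<in> F0" "y \<in> F0" "x < y" for x y
    unfolding r_def
  proof (rule Max_le_if_set_encode_le)
    have "x \<in> F" "y \<in> F" using xy by (auto simp: F0_def)
    then show "finite (fst (dec x))" "finite (fst (dec y))" using finx by auto
    show "set_encode (fst (dec x)) \<le> set_encode (fst (dec y))"
    proof (rule ccontr)
      assume "\<not> ?thesis"
      then have "e (dec y) < e (dec x)"
        using d(1) \<open>x \<in> F\<close> \<open>y \<in> F\<close> by (intro e_less') auto
      then show False using d(2) \<open>x \<in> F\<close> \<open>y \<in> F\<close> xy(3) by simp
    qed
  qed (use ne xy in auto)
  have r_in: "r x \<in> fst (dec x)" if "x \<in> F0" for x
    unfolding r_def using ne[OF that] finx(1)[of x] that by (intro Max_in) (auto simp: F0_def)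
  have coc: "(\<Sum>u\<in>r ` F0. psgn (r ` F0) u * \<phi> (r ` F0 - {u})) = 0" if "inj_on r F0"
  proof (rule cocycle)
    show "r ` F0 \<subseteq> S" using r_in finx by (auto simp: F0_def)
    show "card (r ` F0) = Suc m" using that F0(2) by (simp add: card_image)
    show "indep N (r ` F0)"
      unfolding indep_def
    proof (clarify)
      fix x y assume xy: "x \<in> F0" "y \<in> F0" "N (r x) (r y)"
      then have F': "x \<in> F" "y \<in> F" by (auto simp: F0_def)
      have lxy: "linked N (dec x) (dec y)" using F(2) F' unfolding indep_def N'_def by metis
      have a: "r x \<in> fst (dec x)" "r y \<in> fst (dec y)" using r_in xy by auto
      \<comment> \<open>Both first components are cliques of the old graph, so neither contains both
        \<open>r x\<close> and \<open>r y\<close>; hence both points lie in the clique by which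
        \<open>dec x\<close> and \<open>dec y\<close> differ.\<close>
      have "r y \<notin> fst (dec x)" "r x \<notin> fst (dec y)"
        using ind[OF F'(1)] ind[OF F'(2)] a xy(3) unfolding indep_def by blast+
      then show False using linked_indepD[OF lxy, of "r x" "r y"] a xy(3) by blast
    qed
  qed
  have s: "psgn F x = - (psgn F0 x :: 'k)" if "x \<in> F0" for x
    unfolding F0(3) using v0_less[OF that] F0 by (simp add: psgn_insert)
  have p: "\<phi>' (F - {x}) = (if inj_on r (F0 - {x}) then \<phi> (r ` (F0 - {x})) else 0)" if "x \<in> F0" for x
  proof -
    have "v0 \<in> F - {x}" "F - {x} - {v0} = F0 - {x}" using that F0 by auto
    then show ?thesis by (simp add: \<phi>'_def)
  qed
  have "(\<Sum>x\<in>F. psgn F x * \<phi>' (F - {x})) = (\<Sum>x\<in>F0. psgn F x * \<phi>' (F - {x}))"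
    using F0(1,4) by (subst (1) F0(3)) (simp add: \<phi>'_def)
  also have "\<dots> = - (\<Sum>x\<in>F0. psgn F0 x * (if inj_on r (F0 - {x}) then \<phi> (r ` (F0 - {x})) else 0))"
    unfolding sum_negf[symmetric] by (rule sum.cong) (simp_all add: s p)
  also have "\<dots> = 0" using pull_cocycle[OF F0(1), of r \<phi>] mono coc by simp
  finally show ?thesis .
qed

text \<open>Directions avoid \<open>fst p\<close>, so a flag contains \<open>v0\<close> only if it
  starts there. Along such a flag \<open>r\<close> takes the prefix maxima of \<open>t\<close> as
  values, and these are distinct only for the sorted ordering.\<close>

lemma \<phi>'_cube:
  assumes "(p, t) \<in> cube_flags"
  shows "\<phi>' (vx p t ` {..m}) = (if p = ({}, {}) \<and> sorted_wrt (<) t then \<phi> (set t) else 0)"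
proof -
  have P: "(p, t) \<in> flags m" and len: "length t = m" and sub: "set t \<subseteq> S - fst p" and p\<Omega>: "p \<in> \<Omega>"
    using assms by (auto simp: cube_flags_def flags_def)
  show ?thesis
  proof (cases "p = ({}, {})")
    case False
    have "v0 \<notin> vx p t ` {..m}"
    proof
      assume "v0 \<in> vx p t ` {..m}"
      then obtain i where i: "v0 = vx p t i" by auto
      have "dec v0 = ({}, {})" by (simp add: v0_def dec_e empty_in)
      then have a: "act p (set (take i t)) = ({}, {})" using dec_vx[OF P] i by simp
      have "set (take i t) \<inter> fst p = {}" using sub set_take_subset[of i t] by blast
      then have "fst p = {}" using a by (auto simp: act_def)
      moreover from this have "snd p = {}" using a by (auto simp: act_def)
      ultimately show False using False by (simp add: prod_eq_iff)
    qed
    then show ?thesis using False by (simp add: \<phi>'_def)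
  next
    case True
    have v: "vx p t 0 = v0" by (simp add: vx_def v0_def True act_def)
    have split: "{..m} = insert 0 {1..m}" by auto
    have "v0 < vx p t i" if "i \<in> {1..m}" for i using vx_less[OF P, of 0 i] v that by simp
    then have "v0 \<notin> vx p t ` {1..m}" by (metis imageE less_irrefl)
    then have F: "vx p t ` {..m} - {v0} = vx p t ` {1..m}" "v0 \<in> vx p t ` {..m}"
      unfolding split by (auto simp: v)
    have "r (vx p t i) = Max (set (take i t))" for i
      unfolding r_def dec_vx[OF P] by (simp add: True act_def)
    then have ro: "r \<circ> vx p t = (\<lambda>i. Max (set (take i t)))" by auto
    have inj: "inj_on (vx p t) {1..m}"
      by (rule linorder_inj_onI) (use vx_less[OF P] in \<open>fastforce+\<close>)
    have "inj_on r (vx p t ` {1..m}) \<longleftrightarrow> sorted_wrt (<) t"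
      using comp_inj_on_iff[OF inj, of r] inj_on_Max_prefix_iff[of t] by (simp add: ro len)
    moreover have "r ` vx p t ` {1..m} = set t" if "sorted_wrt (<) t"
      using image_Max_prefix[OF that] by (simp add: image_comp ro len)
    ultimately show ?thesis using True F by (simp add: \<phi>'_def)
  qed
qed

text \<open>Each face of the old complex with \<open>m\<close> vertices contributes through one flag
  only, its sorted ordering started at \<open>v0\<close>, and with sign 1. So the value is preserved
  in every characteristic.\<close>

lemma pairing: "(\<Sum>F\<in>Pow (e ` \<Omega>). Z F * \<phi>' F) = (\<Sum>F\<in>Pow S. z F * \<phi> F)"
proof -
  have "(\<Sum>F\<in>Pow (e ` \<Omega>). Z F * \<phi>' F) =
    (\<Sum>x\<in>cube_flags. \<Sum>F\<in>Pow (e ` \<Omega>). (if F = vx (fst x) (snd x) ` {..m} then weight (fst x) (snd x) * \<phi>' F else 0))"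
    unfolding Z_def sum_distrib_right case_prod_beta
    by (subst sum.swap) (intro sum.cong; simp)
  also have "\<dots> = (\<Sum>x\<in>cube_flags. weight (fst x) (snd x) * \<phi>' (vx (fst x) (snd x) ` {..m}))"
  proof (rule sum.cong)
    fix x assume "x \<in> cube_flags"
    then have "(fst x, snd x) \<in> flags m" by (auto simp: cube_flags_def)
    then have "vx (fst x) (snd x) ` {..m} \<in> Pow (e ` \<Omega>)" using vx_in by blast
    then show "(\<Sum>F\<in>Pow (e ` \<Omega>). (if F = vx (fst x) (snd x) ` {..m} then weight (fst x) (snd x) * \<phi>' F else 0))
      = weight (fst x) (snd x) * \<phi>' (vx (fst x) (snd x) ` {..m})"
      using finite_\<Omega> by (subst sum.delta) simp_all
  qed simp
  also have "\<dots> = (\<Sum>x\<in>cube_flags. if fst x = ({}, {}) \<and> sorted_wrt (<) (snd x) then z (set (snd x)) * \<phi> (set (snd x)) else 0)"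
  proof (rule sum.cong)
    fix x assume "x \<in> cube_flags"
    then have "(fst x, snd x) \<in> cube_flags" by simp
    then show "weight (fst x) (snd x) * \<phi>' (vx (fst x) (snd x) ` {..m}) =
      (if fst x = ({}, {}) \<and> sorted_wrt (<) (snd x) then z (set (snd x)) * \<phi> (set (snd x)) else 0)"
      by (simp add: \<phi>'_cube weight_def list_sign_sorted)
  qed simp
  also have "\<dots> = (\<Sum>x\<in>{x\<in>cube_flags. fst x = ({}, {}) \<and> sorted_wrt (<) (snd x)}. z (set (snd x)) * \<phi> (set (snd x)))"
    using finite_cube_flags by (simp add: sum.If_cases Int_def)
  also have "\<dots> = (\<Sum>F\<in>{F\<in>Pow S. indep N F \<and> card F = m}. z F * \<phi> F)"
  proof (rule sum.reindex_bij_witness[where i = "\<lambda>F. (({}, {}), sorted_list_of_set F)" and j = "\<lambda>x. set (snd x)"])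
    fix x assume "x \<in> {x\<in>cube_flags. fst x = ({}, {}) \<and> sorted_wrt (<) (snd x)}"
    then show "(({}, {}), sorted_list_of_set (set (snd x))) = x" "set (snd x) \<in> {F\<in>Pow S. indep N F \<and> card F = m}"
      by (auto simp: cube_flags_def flags_def distinct_card strict_sorted_iff sorted_list_of_set.idem_if_sorted_distinct prod_eq_iff)
  next
    fix F assume "F \<in> {F\<in>Pow S. indep N F \<and> card F = m}"
    moreover from this have "finite F" using finS finite_subset by auto
    ultimately show "set (snd (({}, {}), sorted_list_of_set F)) = F"
      "(({}, {}), sorted_list_of_set F) \<in> {x\<in>cube_flags. fst x = ({}, {}) \<and> sorted_wrt (<) (snd x)}"
      by (auto simp: cube_flags_def flags_def empty_in)
  qed simp
  also have "\<dots> = (\<Sum>F\<in>Pow S. z F * \<phi> F)"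
  proof (rule sum.mono_neutral_left)
    show "\<forall>F\<in>Pow S - {F\<in>Pow S. indep N F \<and> card F = m}. z F * \<phi> F = 0" using z by auto
  qed (use finS in auto)
  finally show ?thesis .
qed

end

section \<open>Gap-free graphs of large regularity\<close>

text \<open>The cocycle \<open>\<phi>\<close> certifies that \<open>z\<close> is not a boundary,
  because pairing with a cocycle kills boundaries by \<open>bdry_adjoint\<close>. In this form
  non-triviality is the non-vanishing of one number, which \<open>pairing\<close> carries through
  the induction.\<close>

definition witness :: "nat \<Rightarrow> nat set \<Rightarrow> (nat \<Rightarrow> nat \<Rightarrow> bool) \<Rightarrow> (nat set \<Rightarrow> 'k::field) \<Rightarrow> (nat set \<Rightarrow> 'k) \<Rightarrow> bool" where
  "witness m S N z \<phi> \<longleftrightarrow> finite S \<and> symp N \<and> irreflp N \<and> gap_free N \<and>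
    (\<forall>F. z F \<noteq> 0 \<longrightarrow> F \<subseteq> S \<and> indep N F \<and> card F = m) \<and> (\<forall>G. bdry S z G = 0) \<and>
    (\<forall>F. F \<subseteq> S \<longrightarrow> indep N F \<longrightarrow> card F = Suc m \<longrightarrow> (\<Sum>v\<in>F. psgn F v * \<phi> (F - {v})) = 0) \<and>
    (\<Sum>F\<in>Pow S. z F * \<phi> F) \<noteq> 0"

text \<open>The code is a number in base \<open>M\<close> whose leading part is the first component;
  \<open>M\<close> exceeds every code of a second component.\<close>

lemma ex_vertex_encoding:
  assumes "finite S"
  shows "\<exists>e :: vert \<Rightarrow> nat. inj_on e (Pow S \<times> Pow (S \<times> S)) \<and>
    (\<forall>p\<in>Pow S \<times> Pow (S \<times> S). \<forall>q\<in>Pow S \<times> Pow (S \<times> S).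
      set_encode (fst p) < set_encode (fst q) \<longrightarrow> e p < e q)"
proof -
  let ?\<Omega> = "Pow S \<times> Pow (S \<times> S)"
  define M where "M = Suc (set_encode (prod_encode ` (S \<times> S)))"
  define e :: "vert \<Rightarrow> nat" where
    "e p = set_encode (fst p) * M + set_encode (prod_encode ` snd p)" for p
  have fin: "finite (fst p)" "finite (snd p)" if "p \<in> ?\<Omega>" for p
    using that assms finite_subset[of "fst p" S] finite_subset[of "snd p" "S \<times> S"] by auto
  have lt: "set_encode (prod_encode ` snd p) < M" if "p \<in> ?\<Omega>" for p
    unfolding M_def less_Suc_eq_le unfolding set_encode_def
    by (rule sum_mono2) (use that assms in auto)
  have "inj_on e ?\<Omega>"
  proof (rule inj_onI)
    fix p q assume p: "p \<in> ?\<Omega>" and q: "q \<in> ?\<Omega>" and eq: "e p = e q"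
    have "e p div M = set_encode (fst p)" "e p mod M = set_encode (prod_encode ` snd p)"
      "e q div M = set_encode (fst q)" "e q mod M = set_encode (prod_encode ` snd q)"
      using lt[OF p] lt[OF q] by (simp_all add: e_def)
    then have "set_encode (fst p) = set_encode (fst q)"
      "set_encode (prod_encode ` snd p) = set_encode (prod_encode ` snd q)" using eq by metis+
    then have "fst p = fst q" "prod_encode ` snd p = prod_encode ` snd q"
      using fin[OF p] fin[OF q] by (simp_all add: set_encode_eq)
    then show "p = q" by (simp add: prod_eq_iff inj_image_eq_iff[OF inj_prod_encode])
  qed
  moreover have "e p < e q" if "p \<in> ?\<Omega>" "set_encode (fst p) < set_encode (fst q)" for p q
  proof -
    have "e p < Suc (set_encode (fst p)) * M" using lt[OF that(1)] by (simp add: e_def)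
    also have "\<dots> \<le> set_encode (fst q) * M" using that(2) by (intro mult_le_mono1) simp
    also have "\<dots> \<le> e q" by (simp add: e_def)
    finally show ?thesis .
  qed
  ultimately show ?thesis by (intro exI[of _ e] conjI ballI impI)
qed

lemma witness_step:
  assumes w: "witness m S N z (\<phi> :: nat set \<Rightarrow> 'k::field)" and m: "0 < m"
  shows "\<exists>S' N' z' (\<phi>' :: nat set \<Rightarrow> 'k). witness (Suc m) S' N' z' \<phi>'"
proof -
  have S: "finite S" using w by (simp add: witness_def)
  obtain e :: "vert \<Rightarrow> nat" where e: "inj_on e (Pow S \<times> Pow (S \<times> S))"
    "\<And>p q. p \<in> Pow S \<times> Pow (S \<times> S) \<Longrightarrow> q \<in> Pow S \<times> Pow (S \<times> S) \<Longrightarrow>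
      set_encode (fst p) < set_encode (fst q) \<Longrightarrow> e p < e q"
    using ex_vertex_encoding[OF S] by blast
  interpret doubling S N m z \<phi> e
    by unfold_locales (use w m e in \<open>auto simp: witness_def\<close>)
  have "gap_free (\<lambda>p q. \<not> linked N p q)" using w by (intro gap_free_not_linked) (auto simp: witness_def)
  then have "gap_free N'" unfolding gap_free_def N'_def by blast
  moreover have "(\<Sum>F\<in>Pow (e ` \<Omega>). Z F * \<phi>' F) \<noteq> 0" using w by (simp add: pairing witness_def)
  ultimately have "witness (Suc m) (e ` \<Omega>) N' Z \<phi>'"
    unfolding witness_def
    by (intro conjI[OF finite_imageI[OF finite_\<Omega>]] conjI[OF symp_N'] conjI[OF irreflp_N'] conjI[of "gap_free N'"]
      conjI[of "\<forall>F. Z F \<noteq> 0 \<longrightarrow> _ F"] conjI[of "\<forall>G. bdry _ _ G = 0"] conjI[of "\<forall>F. F \<subseteq> _ \<longrightarrow> _ F"]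
      allI impI cycle_Z cocycle_\<phi>' Z_support)
  then show ?thesis by blast
qed

lemma witness_base: "\<exists>S N z (\<phi> :: nat set \<Rightarrow> 'k::field). witness 1 S N z \<phi>"
proof -
  define N :: "nat \<Rightarrow> nat \<Rightarrow> bool" where "N x y \<longleftrightarrow> x \<noteq> y \<and> x < 2 \<and> y < 2" for x y
  define z :: "nat set \<Rightarrow> 'k" where "z F = (if F = {0} then 1 else if F = {1} then - 1 else 0)" for F
  define \<phi> :: "nat set \<Rightarrow> 'k" where "\<phi> F = (if F = {0} then 1 else 0)" for F
  have P: "Pow {0, 1::nat} = {{}, {0}, {1}, {0, 1}}" by (auto simp: Pow_insert)
  have "bdry {0, 1} z G = 0" for G
  proof (cases "G = {}")
    case True
    then show ?thesis by (simp add: bdry_def z_def psgn_def)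
  next
    case False
    then have "z (insert v G) = 0" if "v \<notin> G" for v using that by (auto simp: z_def)
    then show ?thesis by (simp add: bdry_def)
  qed
  moreover have "\<not> (F \<subseteq> {0, 1} \<and> indep N F \<and> card F = Suc 1)" for F
  proof
    assume F: "F \<subseteq> {0, 1} \<and> indep N F \<and> card F = Suc 1"
    then have "F = {0, 1}" by (intro card_subset_eq) auto
    then show False using F by (auto simp: indep_def N_def)
  qed
  moreover have "gap_free N" unfolding gap_free_def N_def by presburger
  moreover have "(\<Sum>F\<in>Pow {0, 1}. z F * \<phi> F) \<noteq> 0" unfolding P by (simp add: z_def \<phi>_def)
  moreover have "z F \<noteq> 0 \<Longrightarrow> F \<subseteq> {0, 1} \<and> indep N F \<and> card F = 1" for F
    by (auto simp: z_def indep_def N_def split: if_splits)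
  moreover have "symp N" "irreflp N" by (auto simp: N_def symp_def irreflp_def)
  ultimately have "witness 1 {0, 1} N z \<phi>"
    unfolding witness_def by blast
  then show ?thesis by blast
qed

lemma ex_witness: "0 < m \<Longrightarrow> \<exists>S N z (\<phi> :: nat set \<Rightarrow> 'k::field). witness m S N z \<phi>"
proof (induction m rule: nat_induct_non_zero)
  case 1
  show ?case by (rule witness_base)
next
  case (Suc m)
  then show ?case using witness_step by blast
qed

text \<open>The coboundary is the transpose of the boundary: pairs of a face and a vertex outside it
  correspond to pairs of a face and a vertex inside it.\<close>

lemma bdry_adjoint:
  assumes "finite S"
  shows "(\<Sum>F\<in>Pow S. bdry S b F * \<phi> F) =
    (\<Sum>F\<in>Pow S. b F * (\<Sum>v\<in>F. psgn F v * \<phi> (F - {v})) :: 'k::field)"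
proof -
  have fin: "finite F" if "F \<in> Pow S" for F using that assms finite_subset by auto
  have "(\<Sum>F\<in>Pow S. bdry S b F * \<phi> F) =
    (\<Sum>(F, v)\<in>(SIGMA F:Pow S. S - F). psgn F v * b (insert v F) * \<phi> F)"
    unfolding bdry_def sum_distrib_right using assms by (subst sum.Sigma) auto
  also have "\<dots> = (\<Sum>(F, v)\<in>(SIGMA F:Pow S. F). b F * (psgn F v * \<phi> (F - {v})))"
    by (rule sum.reindex_bij_witness[where i = "\<lambda>(F, v). (F - {v}, v)" and j = "\<lambda>(F, v). (insert v F, v)"])
      (auto simp: psgn_self_insert mult_ac)
  also have "\<dots> = (\<Sum>F\<in>Pow S. b F * (\<Sum>v\<in>F. psgn F v * \<phi> (F - {v})))"
    unfolding sum_distrib_left using assms fin by (subst sum.Sigma) auto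
  finally show ?thesis .
qed

definition edges :: "nat set \<Rightarrow> (nat \<Rightarrow> nat \<Rightarrow> bool) \<Rightarrow> nat set set" where
  "edges S N = {{x, y} | x y. x \<in> S \<and> y \<in> S \<and> N x y}"

lemma ind_complex_edges: "ind_complex (edges S N) S = {F. F \<subseteq> S \<and> indep N F}"
  by (auto simp: ind_complex_def edges_def indep_def) blast

lemma red_hom_nonzero_witness:
  assumes "witness m S N z (\<phi> :: nat set \<Rightarrow> 'k::field)"
  shows "red_hom_nonzero TYPE('k) (ind_complex (edges S N) S) m"
proof -
  have S: "finite S" using assms by (simp add: witness_def)
  have "bdry S b \<noteq> z" if b: "chain_on (ind_complex (edges S N) S) (Suc m) b" for b
  proof
    assume bz: "bdry S b = z"
    have "b F * (\<Sum>v\<in>F. psgn F v * \<phi> (F - {v})) = 0" for F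
      using b assms by (cases "b F = 0") (auto simp: chain_on_def ind_complex_edges witness_def)
    then have "(\<Sum>F\<in>Pow S. b F * (\<Sum>v\<in>F. psgn F v * \<phi> (F - {v}))) = 0"
      by (intro sum.neutral) blast
    then have "(\<Sum>F\<in>Pow S. z F * \<phi> F) = 0"
      using bdry_adjoint[OF S, of b \<phi>] unfolding bz by simp
    then show False using assms by (simp add: witness_def)
  qed
  moreover have "chain_on (ind_complex (edges S N) S) m z"
    using assms by (auto simp: chain_on_def ind_complex_edges witness_def)
  moreover have "\<forall>G. bdry S z G = 0" using assms by (simp add: witness_def)
  ultimately show ?thesis unfolding red_hom_nonzero_iff_bdry[OF S] by blast
qed

lemma ex_gap_free_reg_ge:
  assumes "0 < n"
  shows "\<exists>S N. finite S \<and> irreflp N \<and> gap_free N \<and> n \<le> reg TYPE('k::field) S (edges S N)"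
proof -
  obtain S N z and \<phi> :: "nat set \<Rightarrow> 'k" where w: "witness n S N z \<phi>" using ex_witness[OF assms] by metis
  then have "finite S" by (simp add: witness_def)
  then show ?thesis
    using reg_ge[OF _ order.refl red_hom_nonzero_witness[OF w]] w by (auto simp: witness_def)
qed

section \<open>Prescribing regularity and induced matching number\<close>

lemma discrete_continuity:
  fixes f :: "'a set \<Rightarrow> nat"
  assumes "finite D" and step: "\<And>v U. f (insert v U) \<le> Suc (f U)" and "f B \<le> n" "n \<le> f (D \<union> B)"
  shows "\<exists>U. B \<subseteq> U \<and> U \<subseteq> D \<union> B \<and> f U = n"
  using assms(1,4)
proof (induction D)
  case empty
  then show ?case using assms(3) by auto
next
  case (insert v D)
  show ?case
  proof (cases "n \<le> f (D \<union> B)")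
    case True
    then show ?thesis using insert.IH by blast
  next
    case False
    then have "f (insert v D \<union> B) = n" using step[of v "D \<union> B"] insert.prems by simp
    then show ?thesis by blast
  qed
qed

lemma reg_cong:
  assumes "\<And>e. e \<subseteq> V \<Longrightarrow> e \<in> E \<longleftrightarrow> e \<in> E'"
  shows "reg k V E = reg k V E'"
proof -
  have "(\<forall>e\<in>E. \<not> e \<subseteq> F) \<longleftrightarrow> (\<forall>e\<in>E'. \<not> e \<subseteq> F)" if "F \<subseteq> V" for F
    using assms order.trans[OF _ that] by blast
  then have "ind_complex E S = ind_complex E' S" if "S \<subseteq> V" for S
    unfolding ind_complex_def using order.trans[OF _ that] by blast
  then show ?thesis unfolding reg_def by (metis (no_types, lifting))
qed

lemma im_eqI:
  assumes "finite E" "induced_matching E M" "\<And>M'. induced_matching E M' \<Longrightarrow> card M' \<le> card M"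
  shows "im E = card M"
proof -
  have "finite {M. induced_matching E M}"
    by (rule finite_subset[of _ "Pow E"]) (use assms(1) in \<open>auto simp: induced_matching_def\<close>)
  then show ?thesis unfolding im_def using assms(2,3) by (intro Max_eqI) auto
qed

text \<open>Two distinct matching edges inside \<open>S\<close> would be joined by an edge. The last
  assumption concerns only vertices covered by \<open>M\<close>, so the lemma also applies after
  vertices have been deleted.\<close>

lemma gap_free_matching:
  assumes gf: "gap_free N" and M: "induced_matching E M"
    and E: "\<And>x y. x \<in> S \<Longrightarrow> y \<in> S \<Longrightarrow> N x y \<Longrightarrow> x \<in> \<Union>M \<Longrightarrow> y \<in> \<Union>M \<Longrightarrow> {x, y} \<in> E"
  shows "card (M \<inter> edges S N) \<le> 1"
proof -
  have "e = f" if ef: "e \<in> M \<inter> edges S N" "f \<in> M \<inter> edges S N" for e f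
  proof -
    obtain s t p q where *: "e = {s, t}" "f = {p, q}" "N s t" "N p q" "{s, t, p, q} \<subseteq> S"
      using ef by (auto simp: edges_def)
    then obtain x y where xy: "x \<in> e" "y \<in> f" "N x y"
      using gf unfolding gap_free_def by (metis insertCI)
    have "x \<in> S" "y \<in> S" using xy * by auto
    moreover have "x \<in> \<Union>M" "y \<in> \<Union>M" using xy ef by auto
    ultimately have "{x, y} \<in> E" using xy(3) by (intro E)
    then have "e = f \<or> \<not> ({x, y} \<inter> e \<noteq> {} \<and> {x, y} \<inter> f \<noteq> {})"
      using M ef unfolding induced_matching_def by (metis IntD1)
    then show "e = f" using xy by auto
  qed
  then show ?thesis
    by (cases "finite (M \<inter> edges S N)") (auto simp: card_le_Suc0_iff_eq)
qed

theorem theorem1p3: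
  fixes n k :: nat
  assumes "1 \<le> k" and "k \<le> n"
  shows "\<exists>V E. simple_graph V E \<and> reg TYPE('f::field) V E = n \<and> im E = k"
proof -
  obtain S N where S: "finite S" and irr: "irreflp N" and gf: "gap_free N"
    and n: "n \<le> reg TYPE('f) S (edges S N)"
    using ex_gap_free_reg_ge[of n, where 'k='f] assms by auto
  \<comment> \<open>All numbers from \<open>c\<close> on are fresh vertices for the
    \<open>k - 1\<close> extra edges; \<open>insert 0\<close> makes the maximum meaningful for empty
    \<open>S\<close>.\<close>
  define c where "c = Suc (Max (insert 0 S))"
  have c: "x < c" if "x \<in> S" for x using that S by (simp add: c_def less_Suc_eq_le)
  define L where "L = (\<lambda>i. {c + 2 * i, c + 2 * i + 1}) ` {..<k - 1}"
  define W where "W = \<Union>L"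
  let ?E1 = "edges S N"
  let ?E = "?E1 \<union> L"
  have E1S: "e \<subseteq> S" "card e = 2" if "e \<in> ?E1" for e
    using that irr by (auto simp: edges_def irreflp_def irreflp_on_def card_insert_if)
  have cardL: "\<forall>e\<in>L. card e = 2" by (auto simp: L_def)
  have E2: "\<forall>e\<in>?E. card e = 2" using E1S cardL by blast
  have finW: "finite W" by (auto simp: W_def L_def)
  have SW: "S \<inter> W = {}" using c by (fastforce simp: W_def L_def)
  have L_disj: "e = f" if ef: "e \<in> L" "f \<in> L" "e \<inter> f \<noteq> {}" for e f
  proof -
    obtain i j where ij: "e = {c + 2 * i, c + 2 * i + 1}" "f = {c + 2 * j, c + 2 * j + 1}"
      using ef(1,2) by (auto simp: L_def)
    then obtain x where "x = c + 2 * i \<or> x = c + 2 * i + 1" "x = c + 2 * j \<or> x = c + 2 * j + 1"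
      using ef(3) by blast
    then have "i = j" by presburger
    then show "e = f" using ij by simp
  qed
  have L_ne: "e \<noteq> {}" "e \<subseteq> W" if "e \<in> L" for e using that by (auto simp: L_def W_def)
  have "?E \<subseteq> Pow (S \<union> W)" using E1S(1) L_ne(2) by blast
  then have finE: "finite ?E" using S finW finite_subset by blast
  have "inj_on (\<lambda>i. {c + 2 * i, c + 2 * i + 1}) {..<k - 1}"
    by (rule inj_onI) (auto simp: doubleton_eq_iff)
  then have cL: "card L = k - 1" "finite L" unfolding L_def by (simp_all add: card_image)
  have "?E1 \<noteq> {}"
  proof
    assume "?E1 = {}"
    then have "reg TYPE('f) S ?E1 = 0" using S by (intro reg_edgeless) auto
    then show False using n assms by simp
  qed
  then obtain p q where pq: "p \<in> S" "q \<in> S" "N p q" by (auto simp: edges_def)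
  have pqE: "{p, q} \<in> ?E1" using pq by (auto simp: edges_def)
  have "p \<noteq> q" using E1S(2)[OF pqE] by auto
  \<comment> \<open>Intersecting with \<open>S\<close> makes the step condition hold for arbitrary
    \<open>v\<close> and \<open>U\<close>, since a \<open>v\<close> outside \<open>S\<close> changes
    nothing.\<close>
  define f where "f U = reg TYPE('f) (U \<inter> S \<union> W) ?E" for U
  have "\<exists>U. {p, q} \<subseteq> U \<and> U \<subseteq> S \<union> {p, q} \<and> f U = n"
  proof (rule discrete_continuity[OF S])
    fix v U
    show "f (insert v U) \<le> Suc (f U)"
      using reg_insert_le[of "U \<inter> S \<union> W" ?E v, where 'k='f] S finW E2
      by (cases "v \<in> S") (auto simp: f_def)
  next
    \<comment> \<open>With one end of each of the \<open>k\<close> edges in \<open>D\<close> and the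
      other in \<open>R\<close>, the set \<open>R\<close> is edgeless and has regularity 0; adding
      the \<open>k\<close> vertices of \<open>D\<close> raises this to at most
      \<open>k\<close>.\<close>
    define D where "D = insert p ((\<lambda>i. c + 2 * i) ` {..<k - 1})"
    define R where "R = insert q ((\<lambda>i. c + 2 * i + 1) ` {..<k - 1})"
    have "W = (\<lambda>i. c + 2 * i) ` {..<k - 1} \<union> (\<lambda>i. c + 2 * i + 1) ` {..<k - 1}"
      by (auto simp: W_def L_def)
    then have DR: "{p, q} \<inter> S \<union> W = D \<union> R" using pq by (auto simp: D_def R_def)
    have "\<not> e \<subseteq> R" if "e \<in> ?E" for e
    proof
      assume e: "e \<subseteq> R"
      show False
      proof (cases "e \<in> ?E1")
        case True
        have "R \<inter> S \<subseteq> {q}" using c by (fastforce simp: R_def)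
        then have "e \<subseteq> {q}" using e E1S(1)[OF True] by blast
        then show False using E1S(2)[OF True] card_mono[of "{q}" e] by simp
      next
        case False
        then obtain i where "c + 2 * i \<in> e" using \<open>e \<in> ?E\<close> by (auto simp: L_def)
        then have "c + 2 * i \<in> R" using e by blast
        then show False using c[OF pq(2)] unfolding R_def by (auto; presburger)
      qed
    qed
    then have "reg TYPE('f) R ?E = 0" using E2 by (intro reg_edgeless) (auto simp: R_def)
    then have "f {p, q} \<le> card D"
      using reg_Un_le[of D R ?E, where 'k='f] E2 unfolding f_def DR by (auto simp: D_def R_def)
    also have "\<dots> \<le> Suc (k - 1)"
      unfolding D_def using card_image_le[of "{..<k - 1}" "\<lambda>i. c + 2 * i"]
      by (auto intro!: order.trans[OF card_insert_le_m1])
    finally show "f {p, q} \<le> n" using assms by simp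
  next
    have "reg TYPE('f) S ?E1 = reg TYPE('f) S ?E"
      using SW L_ne by (intro reg_cong) blast
    also have "\<dots> \<le> reg TYPE('f) (S \<union> W) ?E" using S finW E2 by (intro reg_mono) auto
    also have "\<dots> = f (S \<union> {p, q})" using pq by (simp add: f_def insert_absorb)
    finally show "n \<le> f (S \<union> {p, q})" using n by simp
  qed
  then obtain U where U: "{p, q} \<subseteq> U" "U \<subseteq> S" "f U = n" using pq by auto
  define V where "V = U \<union> W"
  define E where "E = {e \<in> ?E. e \<subseteq> V}"
  have "U \<inter> S = U" using U(2) by blast
  then have "reg TYPE('f) V ?E = n" using U(3) by (simp add: f_def V_def)
  moreover have "reg TYPE('f) V E = reg TYPE('f) V ?E" by (rule reg_cong) (auto simp: E_def)
  ultimately have regV: "reg TYPE('f) V E = n" by simp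
  have "finite V" using U(2) S finW finite_subset by (auto simp: V_def)
  then have graph: "simple_graph V E" using E2 by (auto simp: simple_graph_def E_def)
  let ?M = "insert {p, q} L"
  \<comment> \<open>An edge determines the only member of the matching that it can meet, so no edge
    joins two members.\<close>
  have meets: "e = (if g \<in> ?E1 then {p, q} else g)" if "g \<in> ?E" "e \<in> ?M" "g \<inter> e \<noteq> {}" for g e
  proof (cases "g \<in> ?E1")
    case True
    then have "e \<notin> L" using that E1S(1) L_ne SW by blast
    then show ?thesis using that True by simp
  next
    case False
    then have "g \<in> L" using that by blast
    moreover from this have "e \<noteq> {p, q}" using that L_ne SW pq by blast
    ultimately show ?thesis using that False L_disj by auto
  qed
  have LV: "e \<subseteq> V" if "e \<in> L" for e using L_ne(2)[OF that] by (auto simp: V_def)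
  have "?M \<subseteq> E" using pqE U(1) LV by (auto simp: E_def V_def)
  have "induced_matching E ?M"
    unfolding induced_matching_def
  proof (intro conjI ballI impI \<open>?M \<subseteq> E\<close>)
    fix e f assume ef: "e \<in> ?M" "f \<in> ?M" "e \<noteq> f"
    have *: "\<not> (g \<inter> e \<noteq> {} \<and> g \<inter> f \<noteq> {})" if "g \<in> E" for g
      using meets[of g e] meets[of g f] ef that by (auto simp: E_def)
    then show "\<not> (g \<inter> e \<noteq> {} \<and> g \<inter> f \<noteq> {})" if "g \<in> E" for g using that .
    have "e \<in> E" using ef \<open>?M \<subseteq> E\<close> by blast
    moreover have "e \<noteq> {}" using ef L_ne by auto
    ultimately show "e \<inter> f = {}" using *[of e] by auto
  qed
  moreover have "{p, q} \<notin> L" using L_ne SW pq by blast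
  then have cM: "card ?M = k" using cL assms by simp
  moreover have "card M \<le> k" if M: "induced_matching E M" for M
  proof -
    have ME: "M \<subseteq> E" using M by (simp add: induced_matching_def)
    have "card (M \<inter> ?E1) \<le> 1"
    proof (rule gap_free_matching[OF gf M])
      fix x y assume xy: "x \<in> S" "y \<in> S" "N x y" "x \<in> \<Union>M" "y \<in> \<Union>M"
      then have "{x, y} \<subseteq> V" using ME by (auto simp: E_def)
      then show "{x, y} \<in> E" using xy by (auto simp: E_def edges_def)
    qed
    moreover have "card (M \<inter> L) \<le> k - 1" using card_mono[OF cL(2), of "M \<inter> L"] cL(1) by simp
    moreover have "M = (M \<inter> ?E1) \<union> (M \<inter> L)" using ME by (auto simp: E_def)
    then have "card M \<le> card (M \<inter> ?E1) + card (M \<inter> L)" by (metis card_Un_le)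
    ultimately show ?thesis using assms by linarith
  qed
  ultimately have "im E = k"
    using im_eqI[of E ?M] finite_subset[of E ?E] finE by (auto simp: E_def)
  then show ?thesis using graph regV by blast
qed

end
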